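(* Let $\alpha\in[0,1)$ be a fixed constant, and let $\varepsilon\in(0,1-\alpha)$, $\gamma\in(0,1-\alpha]$ and $K>0$ be arbitrary constants. There exists a constant $c>0$ (depending only on $\alpha,\varepsilon,\gamma,K$) such that, with probability $1-o(1)$ as $n\to\infty$ over the random graph $G\sim\mathcal{G}(n,\frac12,k=\lfloor n^\alpha\rfloor)$ with planted clique $\mathcal{PC}$, the following holds. For every $h:[n]\to\mathbb{R}$ with $h_0=0$ and $|h_q-h_{q'}|\le|q-q'|$ for all $q,q'\le 2.1\log n$, and every inverse temperature $\beta$ with $|\beta|\le K\log n$, there is an initial clique $x_0\in\Omega(G)$ such that the Metropolis process $\{X_t\}$ on $G$ with stationary distribution $\pi_\beta$ started from $X_0=x_0$ requires, with probability at least $1-n^{-c\log n}$, at least $n^{c\log n}$ steps to reach (i) either a clique of size at least $(1+\varepsilon)\log n$, (ii) or a clique of intersection with the planted clique at least $\gamma\log n$. That is, the probability that some $t<n^{c\log n}$ has $|X_t|\ge(1+\varepsilon)\log n$ or $|X_t\cap\mathcal{PC}|\ge\gamma\log n$ is at most $n^{-c\log n}$.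
   Context: Conventions: $\log$ is the base-2 logarithm; $[n]=\{0,1,\dots,n\}$. Planted clique model: $\mathcal{G}(n,\frac12,k)$ is the random graph on an $n$-element vertex set $V$ obtained by sampling $\mathcal{G}(n,\frac12)$ (each pair is an edge independently with probability $1/2$), choosing a uniformly random $k$-subset $\mathcal{PC}\subseteq V$ (the planted clique), and adding all edges between vertices of $\mathcal{PC}$. $\Omega(G)$ denotes the set of all cliques of $G$, i.e. vertex subsets (including $\emptyset$) whose vertices are pairwise adjacent. Gibbs measure: for $h:[n]\to\mathbb{R}$, written $h_q=h(q)$, and $\beta\in\mathbb{R}$, $\pi_\beta(C)\propto\exp(\beta h_{|C|})$ for $C\in\Omega(G)$. Metropolis process: the Markov chain $\{X_t\}$ on $\Omega(G)$ which at step $t$ picks $v\in V$ uniformly at random and sets $C=X_{t-1}\oplus\{v\}$ (symmetric difference). If $C\in\Omega(G)$, then $X_t=C$ with probability $\min\{1,\exp(\beta(h_{|C|}-h_{|X_{t-1}|}))\}$ and $X_t=X_{t-1}$ otherwise. If $C\notin\Omega(G)$, then $X_t=X_{t-1}$. *)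

theory Defs
  imports "HOL-Probability.Probability" "HOL-Probability.Product_PMF"
begin

text \<open>
  The vertex set is \<open>{..<n}\<close>; a graph is represented by its set of edges, each edge
  being a two-element set of vertices.
\<close>

definition all_pairs :: "nat set \<Rightarrow> nat set set" where
  "all_pairs S = {e. e \<subseteq> S \<and> card e = 2}"

definition random_graph :: "nat \<Rightarrow> nat set set pmf" where
  "random_graph n =
     map_pmf (\<lambda>f. {e \<in> all_pairs {..<n}. f e})
       (Pi_pmf (all_pairs {..<n}) False (\<lambda>_. bernoulli_pmf (1/2)))"

text \<open>
  The joint law of the planted graph and the planted clique.  It is meaningful for
  \<open>k \<le> n\<close> only, since \<^const>\<open>pmf_of_set\<close> needs a nonempty set.
\<close>

definition planted_clique :: "nat \<Rightarrow> nat \<Rightarrow> (nat set set \<times> nat set) pmf" where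
  "planted_clique n k =
     bind_pmf (random_graph n) (\<lambda>E.
     bind_pmf (pmf_of_set {S. S \<subseteq> {..<n} \<and> card S = k}) (\<lambda>PC.
     return_pmf (E \<union> all_pairs PC, PC)))"

definition cliques :: "nat \<Rightarrow> nat set set \<Rightarrow> nat set set" where
  "cliques n E = {C. C \<subseteq> {..<n} \<and> (\<forall>u\<in>C. \<forall>v\<in>C. u \<noteq> v \<longrightarrow> {u, v} \<in> E)}"

definition gibbs :: "nat \<Rightarrow> nat set set \<Rightarrow> (nat \<Rightarrow> real) \<Rightarrow> real \<Rightarrow> nat set pmf" where
  "gibbs n E h \<beta> = embed_pmf (\<lambda>C.
     if C \<in> cliques n E
     then exp (\<beta> * h (card C)) / (\<Sum>D\<in>cliques n E. exp (\<beta> * h (card D)))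
     else 0)"

definition metropolis_step ::
  "nat \<Rightarrow> nat set set \<Rightarrow> (nat \<Rightarrow> real) \<Rightarrow> real \<Rightarrow> nat set \<Rightarrow> nat set pmf" where
  "metropolis_step n E h \<beta> X =
     bind_pmf (pmf_of_set {..<n}) (\<lambda>v.
       let C = sym_diff X {v} in
       if C \<in> cliques n E
       then map_pmf (\<lambda>accept. if accept then C else X)
              (bernoulli_pmf (min 1 (exp (\<beta> * (h (card C) - h (card X))))))
       else return_pmf X)"

text \<open>
  The law of the trajectory \<open>[X\<^sub>0, \<dots>, X\<^sub>m]\<close> (a list of length \<open>m + 1\<close>) of the Markov
  chain with transition kernel \<open>P\<close> started from \<open>x\<close>.
\<close>

primrec markov_path :: "('s \<Rightarrow> 's pmf) \<Rightarrow> 's \<Rightarrow> nat \<Rightarrow> 's list pmf" where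
  "markov_path P x 0 = return_pmf [x]"
| "markov_path P x (Suc m) =
     bind_pmf (markov_path P x m) (\<lambda>xs. map_pmf (\<lambda>y. xs @ [y]) (P (last xs)))"

text \<open>
  The Gibbs measure is indeed stationary for the Metropolis chain, which is why the
  chain is referred to as the one with stationary distribution \<^const>\<open>gibbs\<close>.
\<close>

lemma finite_cliques: "finite (cliques n E)"
  by (rule finite_subset[of _ "Pow {..<n}"]) (auto simp: cliques_def)

lemma empty_in_cliques: "{} \<in> cliques n E"
  by (simp add: cliques_def)

lemma partition_function_pos: "(\<Sum>D\<in>cliques n E. exp (\<beta> * h (card D)) :: real) > 0"
  by (rule sum_pos) (use finite_cliques empty_in_cliques[of n E] in auto)

lemma pmf_gibbs:
  "pmf (gibbs n E h \<beta>) C =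
     (if C \<in> cliques n E
      then exp (\<beta> * h (card C)) / (\<Sum>D\<in>cliques n E. exp (\<beta> * h (card D)))
      else 0)"
proof -
  define Z where "Z = (\<Sum>D\<in>cliques n E. exp (\<beta> * h (card D)))"
  have Z: "Z > 0" unfolding Z_def by (rule partition_function_pos)
  have "(\<integral>\<^sup>+C. ennreal (if C \<in> cliques n E then exp (\<beta> * h (card C)) / Z else 0)
            \<partial>count_space UNIV)
      = (\<Sum>C\<in>cliques n E.
           ennreal (if C \<in> cliques n E then exp (\<beta> * h (card C)) / Z else 0))"
    by (rule nn_integral_count_space'[OF finite_cliques]) auto
  also have "\<dots> = (\<Sum>C\<in>cliques n E. ennreal (exp (\<beta> * h (card C)) / Z))"
    by (rule sum.cong) auto
  also have "\<dots> = ennreal (\<Sum>C\<in>cliques n E. exp (\<beta> * h (card C)) / Z)"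
    using Z by (intro sum_ennreal) auto
  also have "(\<Sum>C\<in>cliques n E. exp (\<beta> * h (card C)) / Z) = 1"
    using Z by (simp add: Z_def flip: sum_divide_distrib)
  finally have *: "(\<integral>\<^sup>+C. ennreal (if C \<in> cliques n E then exp (\<beta> * h (card C)) / Z else 0)
            \<partial>count_space UNIV) = 1" by simp
  show ?thesis
    unfolding gibbs_def Z_def[symmetric]
    by (rule pmf_embed_pmf) (use Z * in auto)
qed

lemma detailed_balance:
  assumes n: "n > 0" and C: "C \<in> cliques n E" and D: "D \<in> cliques n E"
  shows "pmf (gibbs n E h \<beta>) C * pmf (metropolis_step n E h \<beta> C) D =
         pmf (gibbs n E h \<beta>) D * pmf (metropolis_step n E h \<beta> D) C"
proof (cases "C = D")
  case False
  define w where "w = (\<lambda>X :: nat set. exp (\<beta> * h (card X)))"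
  have w: "w X > 0" for X by (simp add: w_def)
  have step: "pmf (metropolis_step n E h \<beta> X) Y =
      (\<Sum>v<n. if Y = sym_diff X {v} then min 1 (w Y / w X) else 0) / real n"
    if Y: "Y \<in> cliques n E" and "X \<noteq> Y" for X Y
  proof -
    have "pmf (metropolis_step n E h \<beta> X) Y =
      (\<Sum>v<n. pmf (let C = sym_diff X {v} in
       if C \<in> cliques n E
       then map_pmf (\<lambda>accept. if accept then C else X)
              (bernoulli_pmf (min 1 (exp (\<beta> * (h (card C) - h (card X))))))
       else return_pmf X) Y) / real n"
      unfolding metropolis_step_def
      by (subst pmf_bind_pmf_of_set) (use n in auto)
    also have "\<dots> =
      (\<Sum>v<n. if Y = sym_diff X {v} then min 1 (w Y / w X) else 0) / real n"
    proof (intro arg_cong2[where f = "(/)"] sum.cong refl)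
      fix v
      let ?A = "min 1 (exp (\<beta> * (h (card (sym_diff X {v})) - h (card X))))"
      have A: "0 \<le> ?A" "?A \<le> 1" by auto
      have r: "exp (\<beta> * (h (card Z) - h (card X))) = w Z / w X" for Z
        by (simp add: w_def right_diff_distrib exp_diff)
      have m: "pmf (map_pmf (\<lambda>b. if b then Z else X) (bernoulli_pmf p)) Y
         = (if Y = Z then p else 0)" if "0 \<le> p" "p \<le> 1" for Z p
      proof -
        have eq: "(\<lambda>b. if b then Z else X) -` {Y} = (if Y = Z then {True} else {})"
        proof (rule set_eqI)
          fix b show "b \<in> (\<lambda>b. if b then Z else X) -` {Y} \<longleftrightarrow>
            b \<in> (if Y = Z then {True} else {})"
            using \<open>X \<noteq> Y\<close> by (cases b; cases "Y = Z") simp_all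
        qed
        show ?thesis
        proof (cases "Y = Z")
          case True
          have "pmf (bernoulli_pmf p) True = p" using that by simp
          then show ?thesis unfolding pmf_map eq using True by (simp add: measure_pmf_single)
        next
          case False
          then show ?thesis unfolding pmf_map eq by (simp only: if_False measure_empty)
        qed
      qed
      show "pmf (let C = sym_diff X {v} in
       if C \<in> cliques n E
       then map_pmf (\<lambda>accept. if accept then C else X)
              (bernoulli_pmf (min 1 (exp (\<beta> * (h (card C) - h (card X))))))
       else return_pmf X) Y = (if Y = sym_diff X {v} then min 1 (w Y / w X) else 0)"
      proof (cases "sym_diff X {v} \<in> cliques n E")
        case True
        then have "pmf (let C = sym_diff X {v} in
            if C \<in> cliques n E
            then map_pmf (\<lambda>accept. if accept then C else X)
              (bernoulli_pmf (min 1 (exp (\<beta> * (h (card C) - h (card X))))))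
            else return_pmf X) Y = (if Y = sym_diff X {v} then ?A else 0)"
          unfolding Let_def using m[OF A] by (simp only: if_True)
        then show ?thesis unfolding r by (cases "Y = sym_diff X {v}") (simp_all only: if_True if_False)
      next
        case False
        then have "Y \<noteq> sym_diff X {v}" using Y by blast
        moreover have "pmf (return_pmf X) Y = 0" using \<open>X \<noteq> Y\<close> by simp
        ultimately show ?thesis unfolding Let_def using False by (simp only: if_False)
      qed
    qed
    finally show ?thesis .
  qed
  have swap: "C = sym_diff D {v} \<longleftrightarrow> D = sym_diff C {v}" for v by blast
  have bal: "w C * min 1 (w D / w C) = w D * min 1 (w C / w D)"
    using w[of C] w[of D] by (auto simp: min_def field_simps)
  have "w C * (\<Sum>v<n. if D = sym_diff C {v} then min 1 (w D / w C) else 0)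
      = w D * (\<Sum>v<n. if C = sym_diff D {v} then min 1 (w C / w D) else 0)"
    unfolding sum_distrib_left
    by (rule sum.cong[OF refl], simp only: swap bal if_distrib[of "(*) _"] mult_zero_right)
  moreover have "exp (\<beta> * h (card C)) = w C" "exp (\<beta> * h (card D)) = w D"
    by (simp_all add: w_def)
  ultimately show ?thesis
    using C D False by (simp add: pmf_gibbs step)
qed simp

lemma set_pmf_metropolis_step:
  assumes "n > 0" and "X \<in> cliques n E"
  shows "set_pmf (metropolis_step n E h \<beta> X) \<subseteq> cliques n E"
proof -
  have "{..<n} \<noteq> {}" using assms by auto
  then show ?thesis
    using assms(2) unfolding metropolis_step_def
    by (auto simp: Let_def split: if_splits)
qed

lemma gibbs_stationary:
  assumes n: "n > 0"
  shows "bind_pmf (gibbs n E h \<beta>) (metropolis_step n E h \<beta>) = gibbs n E h \<beta>"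
proof (rule pmf_eqI)
  fix D
  let ?G = "gibbs n E h \<beta>" and ?P = "metropolis_step n E h \<beta>"
  have supp: "set_pmf ?G \<subseteq> cliques n E"
    by (auto simp: set_pmf_eq pmf_gibbs split: if_splits)
  have b: "pmf (bind_pmf ?G ?P) D = (\<Sum>C\<in>cliques n E. pmf ?G C * pmf (?P C) D)"
    unfolding pmf_bind
    by (subst integral_measure_pmf[OF finite_cliques[of n E]]) (use supp in auto)
  show "pmf (bind_pmf ?G ?P) D = pmf ?G D"
  proof (cases "D \<in> cliques n E")
    case True
    have "(\<Sum>C\<in>cliques n E. pmf ?G C * pmf (?P C) D)
        = (\<Sum>C\<in>cliques n E. pmf ?G D * pmf (?P D) C)"
      by (rule sum.cong[OF refl]) (rule detailed_balance[OF n _ True])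
    also have "\<dots> = pmf ?G D"
      using sum_pmf_eq_1[OF finite_cliques set_pmf_metropolis_step[OF n True]]
      by (simp flip: sum_distrib_left)
    finally show ?thesis using b by simp
  next
    case False
    have "pmf (?P C) D = 0" if "C \<in> cliques n E" for C
      using set_pmf_metropolis_step[OF n that] False by (auto simp: set_pmf_eq)
    then show ?thesis using b False by (simp add: pmf_gibbs)
  qed
qed

end

theory Submission
  imports Defs "HOL-Real_Asymp.Real_Asymp"
begin

text \<open>
  Write \<open>L = log 2 n\<close>, and start the chain from the Gibbs measure conditioned on the set \<open>A\<close>
  of cliques of size at most \<open>q \<approx> (1 + 2\<eta>) L\<close> that avoid the planted clique. By
  stationarity it visits a set \<open>B\<close> within \<open>T\<close> steps with probability at most \<open>(T + 1) \<pi>(B) / \<pi>(A)\<close>, so it suffices to separate the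
  starting set \<open>A\<close> from the target by a set \<open>B\<close> of relative weight \<open>n powr - \<Omega>(L)\<close>.

  A path to the target either meets the planted clique in exactly \<open>g \<approx> \<gamma> L\<close> vertices while still
  of size at most \<open>q + r\<close>, where \<open>r \<approx> \<eta> L\<close> (a crossing), or it climbs from size \<open>q\<close> to \<open>q + r\<close>.
  In the second case let \<open>C\<close> be its last clique of size \<open>q\<close>, and stop when exactly \<open>r\<close> vertices
  outside \<open>C\<close> have been collected: these are joined completely to \<open>q - r\<close> vertices of \<open>C\<close>,
  which is rare (Jerrum's gateways). Since a planted vertex costs a factor \<open>n powr (\<alpha> - 1)\<close> in the
  number of choices but saves at most \<open>\<gamma> L \<le> (1 - \<alpha>) L\<close> edges, the planted clique does not increase
  either count. Second moments bound the number of cliques of each size from below. Cliques of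
  equal size have equal Gibbs weight; the only unequal comparison is between sizes in
  \<open>{q..q + r}\<close>, where the weights differ by at most \<open>exp (K \<eta> L\<^sup>2)\<close>, and \<open>\<eta>\<close> is chosen small.
\<close>

subsection \<open>Hitting times of a stationary chain\<close>

lemma markov_path_not_Nil: "X \<in> set_pmf (markov_path P x m) \<Longrightarrow> X \<noteq> []"
  by (cases m) auto

lemma stationary_path_Suc:
  "bind_pmf \<pi> (\<lambda>x. markov_path P x (Suc m)) =
   bind_pmf (bind_pmf \<pi> (\<lambda>x. markov_path P x m)) (\<lambda>xs. map_pmf (\<lambda>y. xs @ [y]) (P (last xs)))"
  by (simp add: bind_assoc_pmf)

lemma stationary_path_last:
  assumes "bind_pmf \<pi> P = \<pi>"
  shows "map_pmf last (bind_pmf \<pi> (\<lambda>x. markov_path P x m)) = \<pi>"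
proof (induction m)
  case 0
  then show ?case by (simp add: map_bind_pmf bind_return_pmf')
next
  case (Suc m)
  have "map_pmf last (bind_pmf \<pi> (\<lambda>x. markov_path P x (Suc m))) =
        bind_pmf (bind_pmf \<pi> (\<lambda>x. markov_path P x m)) (\<lambda>xs. P (last xs))"
    unfolding stationary_path_Suc by (simp add: map_bind_pmf map_pmf_comp)
  also have "\<dots> = bind_pmf (map_pmf last (bind_pmf \<pi> (\<lambda>x. markov_path P x m))) P"
    by (simp add: bind_map_pmf)
  finally show ?case using Suc assms by simp
qed

lemma stationary_path_butlast:
  "map_pmf butlast (bind_pmf \<pi> (\<lambda>x. markov_path P x (Suc m))) =
   bind_pmf \<pi> (\<lambda>x. markov_path P x m)"
  unfolding stationary_path_Suc by (simp add: map_bind_pmf map_pmf_comp bind_return_pmf')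

text \<open>This is a union bound over time: in stationarity each of the \<open>m + 1\<close>
  entries has law \<open>\<pi>\<close>. The induction splits off the last entry, since
  \<open>butlast\<close> turns the longer path into the shorter one and \<open>last\<close> again
  has law \<open>\<pi>\<close>.\<close>

lemma stationary_path_hit:
  assumes "bind_pmf \<pi> P = \<pi>"
  shows "measure_pmf.prob (bind_pmf \<pi> (\<lambda>x. markov_path P x m)) {X. set X \<inter> B \<noteq> {}}
           \<le> (real m + 1) * measure_pmf.prob \<pi> B"
proof (induction m)
  case 0
  have "bind_pmf \<pi> (\<lambda>x. markov_path P x 0) = map_pmf (\<lambda>x. [x]) \<pi>"
    by (simp add: map_pmf_def)
  moreover have "(\<lambda>x. [x]) -` {X. set X \<inter> B \<noteq> {}} = B" by auto
  ultimately show ?case by simp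
next
  case (Suc m)
  let ?Q = "\<lambda>m. bind_pmf \<pi> (\<lambda>x. markov_path P x m)"
  have nn: "X \<noteq> []" if "X \<in> set_pmf (?Q (Suc m))" for X
    using that markov_path_not_Nil[of X P _ "Suc m"] by (auto simp del: markov_path.simps)
  have "measure_pmf.prob (?Q (Suc m)) {X. set X \<inter> B \<noteq> {}} \<le>
        measure_pmf.prob (?Q (Suc m)) (butlast -` {X. set X \<inter> B \<noteq> {}} \<union> last -` B)"
  proof (rule measure_pmf.finite_measure_mono_AE)
    have "X \<noteq> [] \<Longrightarrow> set X \<inter> B \<noteq> {} \<Longrightarrow> set (butlast X) \<inter> B \<noteq> {} \<or> last X \<in> B" for X
      by (cases X rule: rev_cases) auto
    then show "AE X in ?Q (Suc m). X \<in> {X. set X \<inter> B \<noteq> {}} \<longrightarrow>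
            X \<in> butlast -` {X. set X \<inter> B \<noteq> {}} \<union> last -` B"
      using nn unfolding AE_measure_pmf_iff by blast
  qed auto
  also have "\<dots> \<le> measure_pmf.prob (?Q (Suc m)) (butlast -` {X. set X \<inter> B \<noteq> {}})
               + measure_pmf.prob (?Q (Suc m)) (last -` B)"
    by (rule measure_Un_le) auto
  also have "\<dots> = measure_pmf.prob (map_pmf butlast (?Q (Suc m))) {X. set X \<inter> B \<noteq> {}}
               + measure_pmf.prob (map_pmf last (?Q (Suc m))) B"
    by (simp only: measure_map_pmf)
  also have "\<dots> = measure_pmf.prob (?Q m) {X. set X \<inter> B \<noteq> {}} + measure_pmf.prob \<pi> B"
    by (simp only: stationary_path_butlast stationary_path_last[OF assms])
  finally show ?case using Suc by (simp add: algebra_simps)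
qed

text \<open>Averaging: if every start in \<open>A\<close> hit \<open>B\<close> with probability
  above \<open>\<delta>\<close>, then the stationary chain would hit \<open>B\<close> with
  probability above \<open>\<delta>\<close> times the mass of \<open>A\<close>, against the union
  bound. Restricting to the support makes all weights positive, and \<open>pos\<close> makes the
  index set nonempty, so the inequality is strict.\<close>

lemma stationary_escape:
  assumes stat: "bind_pmf \<pi> P = \<pi>" and fin: "finite (set_pmf \<pi>)"
    and bound: "(real m + 1) * measure_pmf.prob \<pi> B \<le> \<delta> * measure_pmf.prob \<pi> A"
    and pos: "0 < measure_pmf.prob \<pi> A"
  shows "\<exists>x\<in>A \<inter> set_pmf \<pi>. measure_pmf.prob (markov_path P x m) {X. set X \<inter> B \<noteq> {}} \<le> \<delta>"
proof (rule ccontr)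
  let ?f = "\<lambda>x. measure_pmf.prob (markov_path P x m) {X. set X \<inter> B \<noteq> {}}"
  let ?S = "set_pmf \<pi>"
  assume neg: "\<not> (\<exists>x\<in>A \<inter> ?S. ?f x \<le> \<delta>)"
  have pA: "measure_pmf.prob \<pi> A = (\<Sum>x\<in>A \<inter> ?S. pmf \<pi> x)"
    using fin measure_measure_pmf_finite[of "A \<inter> ?S" \<pi>] by (simp add: measure_Int_set_pmf)
  have ne: "A \<inter> ?S \<noteq> {}" using pos pA by auto
  have "\<delta> * measure_pmf.prob \<pi> A = (\<Sum>x\<in>A \<inter> ?S. pmf \<pi> x * \<delta>)"
    unfolding pA by (simp add: sum_distrib_left mult.commute)
  also have "\<dots> < (\<Sum>x\<in>A \<inter> ?S. pmf \<pi> x * ?f x)"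
    using neg ne fin by (intro sum_strict_mono mult_strict_left_mono) (auto simp: pmf_positive not_le)
  also have "\<dots> \<le> (\<Sum>x\<in>?S. pmf \<pi> x * ?f x)"
    using fin by (intro sum_mono2) auto
  also have "\<dots> = measure_pmf.prob (bind_pmf \<pi> (\<lambda>x. markov_path P x m)) {X. set X \<inter> B \<noteq> {}}"
    unfolding measure_pmf_bind using fin
    by (subst measure_pmf.measure_bind[where N="count_space UNIV"])
       (auto simp: integral_measure_pmf[OF fin] space_subprob_algebra intro: prob_space_imp_subprob_space prob_space_measure_pmf)
  also have "\<dots> \<le> \<delta> * measure_pmf.prob \<pi> A"
    using stationary_path_hit[OF stat] bound by (rule order_trans)
  finally show False by simp
qed

section \<open>From the law of the path to deterministic properties of its trajectories\<close>

lemma markov_path_chain: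
  assumes "X \<in> set_pmf (markov_path P x m)"
  shows "length X = Suc m \<and> X ! 0 = x \<and> (\<forall>i<m. X ! Suc i \<in> set_pmf (P (X ! i)))"
  using assms
proof (induction m arbitrary: X)
  case (Suc m)
  then obtain xs y where X: "X = xs @ [y]" "xs \<in> set_pmf (markov_path P x m)" "y \<in> set_pmf (P (last xs))"
    by auto
  with Suc.IH[of xs] have "length xs = Suc m" "xs ! 0 = x" "\<forall>i<m. xs ! Suc i \<in> set_pmf (P (xs ! i))"
    by auto
  moreover from this have "last xs = xs ! m" by (metis last_conv_nth diff_Suc_1 list.size(3) nat.distinct(1))
  ultimately show ?case using X by (auto simp: nth_append less_Suc_eq)
qed auto

lemma metropolis_step_cases:
  assumes "n > 0" "Y \<in> set_pmf (metropolis_step n E h \<beta> X)"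
  shows "\<exists>v. Y = X \<or> Y = sym_diff X {v}"
proof -
  have "{..<n} \<noteq> {}" using assms by auto
  then show ?thesis using assms(2) unfolding metropolis_step_def
    by (auto simp: Let_def split: if_splits)
qed

subsection \<open>Crossing the barrier\<close>

text \<open>Only upward jumps have to be bounded by one; \<open>f\<close> may drop by any amount,
  since the first value at or above \<open>y\<close> is reached from below.\<close>

lemma nat_intermediate_value:
  fixes f :: "nat \<Rightarrow> nat"
  assumes "\<And>i. \<lbrakk>a \<le> i; i < b\<rbrakk> \<Longrightarrow> f (Suc i) \<le> f i + 1"
    and "a \<le> b" "f a \<le> y" "y \<le> f b"
  shows "\<exists>i. a \<le> i \<and> i \<le> b \<and> f i = y"
  using \<open>a \<le> b\<close> assms(1,3,4)
proof (induction b rule: dec_induct)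
  case base
  then show ?case by auto
next
  case (step b)
  show ?case
  proof (cases "y \<le> f b")
    case True
    then show ?thesis using step by (metis le_SucI less_SucI)
  next
    case False
    then have "f (Suc b) = y" using step.prems step.hyps by (metis Suc_eq_plus1 Suc_leI lessI le_antisym not_le le_trans)
    then show ?thesis using step.hyps by (intro exI[of _ "Suc b"]) auto
  qed
qed

lemma card_sym_diff_single:
  assumes "finite X"
  shows "card (sym_diff X {v} \<inter> S) \<le> card (X \<inter> S) + 1"
    "card (sym_diff X {v} - S) \<le> card (X - S) + 1"
proof -
  have "card (sym_diff X {v} \<inter> S) \<le> card (insert v (X \<inter> S))"
    using assms by (intro card_mono) auto
  then show "card (sym_diff X {v} \<inter> S) \<le> card (X \<inter> S) + 1"
    using assms by (metis Suc_eq_plus1 card_insert_if finite_Int le_SucI)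
  have "card (sym_diff X {v} - S) \<le> card (insert v (X - S))"
    using assms by (intro card_mono) auto
  then show "card (sym_diff X {v} - S) \<le> card (X - S) + 1"
    using assms by (metis Suc_eq_plus1 card_insert_if finite_Diff le_SucI)
qed

text \<open>A static trace of a climb from \<open>C\<close>: \<open>R\<close> consists of
  \<open>r\<close> newly collected vertices and \<open>D\<close> of \<open>q - r\<close> vertices
  kept from \<open>C\<close>. The condition refers to the graph alone and not to the chain, so it
  can be handled by a first moment. The two bounds by \<open>g\<close> limit the number of edges
  that the planted clique provides for free.\<close>

definition gateways :: "nat \<Rightarrow> nat set set \<Rightarrow> nat set \<Rightarrow> nat \<Rightarrow> nat \<Rightarrow> nat \<Rightarrow> nat set set" where
  "gateways n E PC q r g = {C \<in> cliques n E. card C = q \<and> card (C \<inter> PC) < g \<and>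
     (\<exists>D R. D \<subseteq> C \<and> card D = q - r \<and> R \<inter> C = {} \<and> card R = r \<and>
        R \<union> D \<in> cliques n E \<and> card ((R \<union> D) \<inter> PC) < g)}"

definition crossings :: "nat \<Rightarrow> nat set set \<Rightarrow> nat set \<Rightarrow> nat \<Rightarrow> nat \<Rightarrow> nat set set" where
  "crossings n E PC s g = {C \<in> cliques n E. card C = s \<and> card (C \<inter> PC) = g}"

lemma cliques_subset: "C \<in> cliques n E \<Longrightarrow> D \<subseteq> C \<Longrightarrow> D \<in> cliques n E"
  by (auto simp: cliques_def)

lemma finite_clique: "C \<in> cliques n E \<Longrightarrow> finite C"
  by (auto simp: cliques_def intro: finite_subset)

text \<open>Consider the first time \<open>\<tau>\<close> at which the goal holds. If the planted
  clique is responsible, then unit steps force exactly \<open>g\<close> planted vertices and size at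
  most \<open>q + r\<close>. Otherwise the last earlier time \<open>\<sigma>\<close> with size at
  most \<open>q\<close> yields a gateway.\<close>

lemma barrier_crossed:
  fixes X :: "nat \<Rightarrow> nat set"
  assumes clq: "\<And>i. i \<le> T \<Longrightarrow> X i \<in> cliques n E"
    and step: "\<And>i. i < T \<Longrightarrow> \<exists>v. X (Suc i) = X i \<or> X (Suc i) = sym_diff (X i) {v}"
    and start: "card (X 0) \<le> q" "X 0 \<inter> PC = {}"
    and rq: "0 < r" "r \<le> q" "0 < g"
    and goal: "t0 \<le> T" "q + r \<le> card (X t0) \<or> g \<le> card (X t0 \<inter> PC)"
  shows "\<exists>t\<le>T. X t \<in> gateways n E PC q r g \<or> (\<exists>s\<le>q + r. X t \<in> crossings n E PC s g)"
proof -
  define bad where "bad t \<longleftrightarrow> q + r \<le> card (X t) \<or> g \<le> card (X t \<inter> PC)" for t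
  define \<tau> where "\<tau> = (LEAST t. bad t)"
  have bad: "bad \<tau>" unfolding \<tau>_def by (rule LeastI[of bad t0]) (use goal bad_def in auto)
  have "\<tau> \<le> t0" unfolding \<tau>_def by (rule Least_le) (use goal bad_def in auto)
  then have \<tau>T: "\<tau> \<le> T" using goal by simp
  have nbad: "\<not> bad t" if "t < \<tau>" for t using that unfolding \<tau>_def by (rule not_less_Least)
  have "\<not> bad 0" using start rq by (auto simp: bad_def)
  with bad have "\<tau> > 0" by (metis gr0I)
  have fin: "finite (X i)" if "i \<le> T" for i using clq[OF that] by (rule finite_clique)
  have int: "card (X (Suc i) \<inter> S) \<le> card (X i \<inter> S) + 1"
    and dif: "card (X (Suc i) - S) \<le> card (X i - S) + 1"
    if "i < T" for i S
    using step[OF that] card_sym_diff_single[OF fin, of i] that by auto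
  have siz: "card (X (Suc i)) \<le> card (X i) + 1" if "i < T" for i
    using int[OF that, of UNIV] by simp
  obtain \<sigma>0 where \<sigma>0: "\<tau> = Suc \<sigma>0" using \<open>\<tau> > 0\<close> gr0_implies_Suc by blast
  have prev: "card (X \<sigma>0) < q + r" "card (X \<sigma>0 \<inter> PC) < g"
    using nbad[of \<sigma>0] by (auto simp: \<sigma>0 bad_def)
  have \<sigma>0T: "\<sigma>0 < T" using \<sigma>0 \<tau>T by simp
  show ?thesis
  proof (cases "g \<le> card (X \<tau> \<inter> PC)")
    case True
    then have "card (X \<tau> \<inter> PC) = g" using int[OF \<sigma>0T, of PC] prev \<sigma>0 by simp
    moreover have "card (X \<tau>) \<le> q + r" using siz[OF \<sigma>0T] prev \<sigma>0 by simp
    ultimately show ?thesis using clq[OF \<tau>T] \<tau>T unfolding crossings_def by blast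
  next
    case False
    then have big: "q + r \<le> card (X \<tau>)" using bad by (auto simp: bad_def)
    have small: "card (X t \<inter> PC) < g" if "t \<le> \<tau>" for t
      using that False nbad[of t] by (cases "t = \<tau>") (auto simp: bad_def)
    define low where "low = {t. t \<le> \<tau> \<and> card (X t) \<le> q}"
    have finl: "finite low" and nel: "low \<noteq> {}" using start by (auto simp: low_def)
    define \<sigma> where "\<sigma> = Max low"
    have "\<sigma> \<in> low" unfolding \<sigma>_def using finl nel by (rule Max_in)
    then have \<sigma>: "\<sigma> \<le> \<tau>" "card (X \<sigma>) \<le> q" by (auto simp: low_def)
    have up: "q < card (X t)" if "\<sigma> < t" "t \<le> \<tau>" for t
      using Max_ge[OF finl, of t] that unfolding \<sigma>_def[symmetric] by (auto simp: low_def not_le[symmetric])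
    have "\<sigma> < \<tau>" using \<sigma> big rq by (cases "\<sigma> = \<tau>") auto
    \<comment> \<open>The next state already exceeds \<open>q\<close>, and one step adds at most one
      vertex.\<close>
    then have \<sigma>q: "card (X \<sigma>) = q" using up[of "Suc \<sigma>"] siz[of \<sigma>] \<sigma> \<tau>T by simp
    have "r \<le> card (X \<tau> - X \<sigma>)"
      using big \<sigma>q diff_card_le_card_Diff[of "X \<sigma>" "X \<tau>"] fin[of \<sigma>] \<open>\<sigma> < \<tau>\<close> \<tau>T by simp
    then obtain t where t: "\<sigma> \<le> t" "t \<le> \<tau>" "card (X t - X \<sigma>) = r"
      using nat_intermediate_value[of \<sigma> \<tau> "\<lambda>t. card (X t - X \<sigma>)" r] dif \<open>\<sigma> < \<tau>\<close> \<tau>T by auto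
    \<comment> \<open>After \<open>\<sigma>\<close> the size never falls below \<open>q\<close>.
      With exactly \<open>r\<close> vertices outside \<open>X \<sigma>\<close>, at least
      \<open>q - r\<close> vertices of \<open>X \<sigma>\<close> must therefore remain, and
      \<open>D\<close> is chosen among them.\<close>
    have qt: "q \<le> card (X t)" using up[of t] t \<sigma>q by (cases "\<sigma> = t") auto
    have "card (X t) = card (X t \<inter> X \<sigma>) + card (X t - X \<sigma>)"
      using fin[of t] t \<tau>T by (metis card_Int_Diff add.commute le_trans)
    then have "q - r \<le> card (X t \<inter> X \<sigma>)" using qt t by simp
    then obtain D where D: "D \<subseteq> X t \<inter> X \<sigma>" "card D = q - r"
      by (meson obtain_subset_with_card_n)
    have "(X t - X \<sigma>) \<union> D \<in> cliques n E"
    proof (rule cliques_subset)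
      show "X t \<in> cliques n E" using clq t \<tau>T by simp
      show "X t - X \<sigma> \<union> D \<subseteq> X t" using D by blast
    qed
    moreover have "card (((X t - X \<sigma>) \<union> D) \<inter> PC) < g"
    proof -
      have "card (((X t - X \<sigma>) \<union> D) \<inter> PC) \<le> card (X t \<inter> PC)"
        using D fin[of t] t \<tau>T by (intro card_mono) auto
      then show ?thesis using small[of t] t by simp
    qed
    moreover have "D \<subseteq> X \<sigma>" "card D = q - r" "(X t - X \<sigma>) \<inter> X \<sigma> = {}"
      using D by auto
    moreover have "X \<sigma> \<in> cliques n E" "card (X \<sigma> \<inter> PC) < g"
      using \<sigma> clq \<tau>T small by simp_all
    ultimately have "X \<sigma> \<in> gateways n E PC q r g"
      using \<sigma>q t(3) unfolding gateways_def by blast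
    then show ?thesis using \<open>\<sigma> < \<tau>\<close> \<tau>T by (intro exI[of _ \<sigma>]) auto
  qed
qed

subsection \<open>First and second moments of subgraph counts\<close>

lemma finite_all_pairs: "finite S \<Longrightarrow> finite (all_pairs S)"
  by (auto simp: all_pairs_def)

lemma card_all_pairs: "finite S \<Longrightarrow> card (all_pairs S) = card S choose 2"
  unfolding all_pairs_def by (rule n_subsets)

lemma all_pairs_mono: "S \<subseteq> T \<Longrightarrow> all_pairs S \<subseteq> all_pairs T"
  by (auto simp: all_pairs_def)

lemma all_pairs_Int: "all_pairs S \<inter> all_pairs T = all_pairs (S \<inter> T)"
  by (auto simp: all_pairs_def)

lemma real_choose_two: "real (n choose 2) = real n * (real n - 1) / 2"
proof (induction n)
  case (Suc n)
  have "Suc n choose 2 = n + (n choose 2)" by (simp add: numeral_2_eq_2)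
  then show ?case using Suc by (simp add: field_simps)
qed simp

lemma finite_set_random_graph: "finite (set_pmf (random_graph n))"
proof (rule finite_subset)
  show "set_pmf (random_graph n) \<subseteq> Pow (all_pairs {..<n})"
    by (auto simp: random_graph_def)
qed (simp add: finite_all_pairs)

lemma prob_random_graph_supset:
  assumes "F \<subseteq> all_pairs {..<n}"
  shows "measure_pmf.prob (random_graph n) {E. F \<subseteq> E} = (1/2) ^ card F"
proof -
  let ?A = "all_pairs {..<n}"
  have fin: "finite ?A" by (simp add: finite_all_pairs)
  have "(\<lambda>f. {e \<in> ?A. f e}) -` {E. F \<subseteq> E} = Pi ?A (\<lambda>e. if e \<in> F then {True} else UNIV)"
    using assms by (auto simp: Pi_def)
  then have "measure_pmf.prob (random_graph n) {E. F \<subseteq> E} =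
      (\<Prod>e\<in>?A. measure_pmf.prob (bernoulli_pmf (1/2)) (if e \<in> F then {True} else UNIV))"
    unfolding random_graph_def by (simp add: measure_Pi_pmf_Pi fin)
  also have "\<dots> = (\<Prod>e\<in>?A. if e \<in> F then 1/2 else 1)"
    by (intro prod.cong) (auto simp: measure_pmf_single)
  also have "\<dots> = (\<Prod>e\<in>?A \<inter> F. 1/2)"
    using fin by (rule prod.inter_restrict[symmetric])
  also have "?A \<inter> F = F" using assms by blast
  finally show ?thesis by simp
qed

lemma card_filter_sum: "finite I \<Longrightarrow> real (card {i \<in> I. P i}) = (\<Sum>i\<in>I. indicator {i. P i} i)"
  by (simp add: indicator_def sum.If_cases Int_def)

lemma integrable_random_graph [simp]: "integrable (measure_pmf (random_graph n)) (f :: _ \<Rightarrow> real)"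
  by (rule integrable_measure_pmf_finite[OF finite_set_random_graph])

text \<open>The index set is arbitrary so that the same formula serves single cliques, pairs of
  cliques in the second moment, and the triples that witness gateways.\<close>

lemma expectation_count:
  assumes "finite I" "\<And>i. i \<in> I \<Longrightarrow> F i \<subseteq> all_pairs {..<n}"
  shows "measure_pmf.expectation (random_graph n) (\<lambda>E. real (card {i \<in> I. F i \<subseteq> E}))
           = (\<Sum>i\<in>I. (1/2) ^ card (F i))"
proof -
  have eq: "real (card {i \<in> I. F i \<subseteq> E}) = (\<Sum>i\<in>I. indicator {E. F i \<subseteq> E} E)" for E
    using assms(1) by (simp add: card_filter_sum indicator_def)
  show ?thesis
    unfolding eq using assms by (simp add: prob_random_graph_supset)
qed

lemma markov_random_graph:
  assumes "\<And>E. 0 \<le> (f E :: real)" "0 < c"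
  shows "measure_pmf.prob (random_graph n) {E. c \<le> f E} \<le> measure_pmf.expectation (random_graph n) f / c"
  using integral_Markov_inequality_measure[of "random_graph n" f UNIV c] assms by simp

lemma count_exceeds:
  assumes "finite I" "\<And>i. i \<in> I \<Longrightarrow> F i \<subseteq> all_pairs {..<n}"
    and "(\<Sum>i\<in>I. (1/2) ^ card (F i)) \<le> b" "0 < b" "0 < M"
  shows "measure_pmf.prob (random_graph n) {E. M * b \<le> real (card {i \<in> I. F i \<subseteq> E})} \<le> 1 / M"
proof -
  have "measure_pmf.prob (random_graph n) {E. M * b \<le> real (card {i \<in> I. F i \<subseteq> E})}
      \<le> (\<Sum>i\<in>I. (1/2) ^ card (F i)) / (M * b)"
    using markov_random_graph[of "\<lambda>E. real (card {i \<in> I. F i \<subseteq> E})" "M * b" n] assms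
    by (simp add: expectation_count)
  also have "\<dots> \<le> b / (M * b)" using assms by (intro divide_right_mono) auto
  also have "\<dots> = 1 / M" using assms by simp
  finally show ?thesis .
qed

section \<open>Overlaps of vertex subsets and the second moment method\<close>

lemma binomial_diff_le:
  assumes "t \<le> s" "s \<le> m"
  shows "real ((m - t) choose (s - t)) \<le> real (m choose s) * (real s / real m) ^ t"
  using assms
proof (induction t arbitrary: s m)
  case (Suc t)
  then obtain s' m' where sm: "s = Suc s'" "m = Suc m'" by (metis Suc_le_D le_trans)
  then have le: "t \<le> s'" "s' \<le> m'" using Suc.prems by auto
  have abs: "real s * real (m choose s) = real m * real (m' choose s')"
    unfolding sm of_nat_mult[symmetric] by (simp only: binomial_absorption diff_Suc_1)
  have "real ((m - Suc t) choose (s - Suc t)) \<le> real (m' choose s') * (real s' / real m') ^ t"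
    using Suc.IH[OF le] by (simp add: sm)
  \<comment> \<open>Removing one element from both sets can only lower the ratio: (s - 1) / (m - 1)
    \<le> s / m when s \<le> m.\<close>
  also have "\<dots> \<le> real (m' choose s') * (real s / real m) ^ t"
    using le by (intro mult_left_mono power_mono) (auto simp: sm divide_simps distrib_left distrib_right)
  also have "real (m' choose s') = real (m choose s) * (real s / real m)"
    using abs by (simp add: sm field_simps)
  finally show ?case by simp
qed simp

lemma card_supersets_le:
  assumes "finite U" "T \<subseteq> U" "card T \<le> s"
  shows "card {C. C \<subseteq> U \<and> card C = s \<and> T \<subseteq> C} \<le> (card U - card T) choose (s - card T)"
proof -
  have "card {C. C \<subseteq> U \<and> card C = s \<and> T \<subseteq> C} \<le> card {C. C \<subseteq> U - T \<and> card C = s - card T}"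
  proof (rule card_inj_on_le)
    show "inj_on (\<lambda>C. C - T) {C. C \<subseteq> U \<and> card C = s \<and> T \<subseteq> C}"
      by (rule inj_onI) blast
    show "(\<lambda>C. C - T) ` {C. C \<subseteq> U \<and> card C = s \<and> T \<subseteq> C} \<subseteq> {C. C \<subseteq> U - T \<and> card C = s - card T}"
      using assms finite_subset[OF _ assms(1)] by (auto simp: card_Diff_subset)
  qed (use assms in auto)
  also have "\<dots> = (card U - card T) choose (s - card T)"
    using assms finite_subset[OF assms(2,1)] by (simp add: n_subsets card_Diff_subset)
  finally show ?thesis .
qed

lemma sum_Pow_power_card:
  "finite C \<Longrightarrow> (\<Sum>T\<in>Pow C. (x::real) ^ card T) = (1 + x) ^ card C"
  using prod_add[of C "\<lambda>_. x" "\<lambda>_. 1"] by (simp add: add.commute)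

text \<open>Group the sets \<open>D\<close> by \<open>T = C \<inter> D\<close>. At most a fraction
  \<open>(s / m) ^ card T\<close> of all \<open>s\<close>-subsets contains \<open>T\<close>, and
  \<open>card T choose 2\<close> is at most \<open>card T * (s - 1) / 2\<close>. Making the exponent
  linear in this way leaves a factor \<open>\<rho>\<close> per element of \<open>T\<close>, and the
  sum over all \<open>T\<close> is a binomial expansion.\<close>

lemma overlap_sum_le:
  fixes U :: "nat set"
  assumes fin: "finite U" and C: "C \<subseteq> U" "card C = s" and m: "card U = m"
  defines "\<rho> \<equiv> real s / real m * 2 powr ((real s - 1) / 2)"
  shows "(\<Sum>D | D \<subseteq> U \<and> card D = s. 2 ^ (card (C \<inter> D) choose 2)) \<le> real (m choose s) * (1 + \<rho>) ^ s"
proof -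
  let ?I = "{D. D \<subseteq> U \<and> card D = s}"
  have finI: "finite ?I" using fin by simp
  have finC: "finite C" using C fin finite_subset by blast
  have "(\<Sum>D\<in>?I. 2 ^ (card (C \<inter> D) choose 2)) =
        (\<Sum>T\<in>Pow C. \<Sum>D | D \<in> ?I \<and> C \<inter> D = T. (2::real) ^ (card (C \<inter> D) choose 2))"
    by (rule sum.group[symmetric]) (use finI finC in auto)
  also have "\<dots> \<le> (\<Sum>T\<in>Pow C. real (m choose s) * \<rho> ^ card T)"
  proof (rule sum_mono)
    fix T assume "T \<in> Pow C"
    then have T: "T \<subseteq> C" "card T \<le> s" "T \<subseteq> U" using C card_mono[OF finC, of T] by auto
    have sm: "s \<le> m" using C m card_mono[OF fin, of C] by simp
    have "(\<Sum>D | D \<in> ?I \<and> C \<inter> D = T. (2::real) ^ (card (C \<inter> D) choose 2)) =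
          real (card {D \<in> ?I. C \<inter> D = T}) * 2 ^ (card T choose 2)"
      by (subst sum.cong[OF refl, where h = "\<lambda>_. 2 ^ (card T choose 2)"]) auto
    also have "\<dots> \<le> real (m choose s) * (real s / real m) ^ card T * 2 ^ (card T choose 2)"
    proof (rule mult_right_mono)
      have "card {D \<in> ?I. C \<inter> D = T} \<le> card {D. D \<subseteq> U \<and> card D = s \<and> T \<subseteq> D}"
        using fin by (intro card_mono) auto
      also have "\<dots> \<le> (m - card T) choose (s - card T)"
        using card_supersets_le[OF fin T(3,2)] m by simp
      finally show "real (card {D \<in> ?I. C \<inter> D = T}) \<le> real (m choose s) * (real s / real m) ^ card T"
        using binomial_diff_le[OF T(2) sm] by linarith
    qed simp
    also have "\<dots> \<le> real (m choose s) * (real s / real m) ^ card T * (2 powr ((real s - 1) / 2)) ^ card T"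
    proof (rule mult_left_mono)
      have "(2::real) ^ (card T choose 2) = 2 powr (real (card T) * ((real (card T) - 1) / 2))"
        by (simp add: powr_realpow[symmetric] real_choose_two)
      also have "\<dots> \<le> 2 powr (real (card T) * ((real s - 1) / 2))"
        using T by (intro powr_mono mult_left_mono) auto
      also have "\<dots> = (2 powr ((real s - 1) / 2)) ^ card T"
        by (simp add: powr_powr powr_realpow[symmetric] mult.commute)
      finally show "(2::real) ^ (card T choose 2) \<le> (2 powr ((real s - 1) / 2)) ^ card T" .
    qed simp
    finally show "(\<Sum>D | D \<in> ?I \<and> C \<inter> D = T. (2::real) ^ (card (C \<inter> D) choose 2)) \<le>
        real (m choose s) * \<rho> ^ card T"
      by (simp add: \<rho>_def power_mult_distrib[symmetric] mult.assoc)
  qed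
  also have "\<dots> = real (m choose s) * (1 + \<rho>) ^ s"
    using finC C by (simp add: sum_distrib_left[symmetric] sum_Pow_power_card)
  finally show ?thesis .
qed

text \<open>Chebyshev's inequality at distance \<open>\<mu> / 2\<close> from the mean. The overlap
  bound gives a relative variance of at most \<open>(1 + \<rho>) ^ s - 1\<close>, and the factor 4
  comes from the halved distance.\<close>

lemma few_cliques_prob:
  fixes U :: "nat set"
  assumes U: "U \<subseteq> {..<n}" "card U = m" and s: "s \<le> m"
  defines "\<rho> \<equiv> real s / real m * 2 powr ((real s - 1) / 2)"
    and "\<mu> \<equiv> real (m choose s) * (1/2) ^ (s choose 2)"
  shows "measure_pmf.prob (random_graph n)
      {E. real (card {C. C \<subseteq> U \<and> card C = s \<and> all_pairs C \<subseteq> E}) \<le> \<mu> / 2} \<le> 4 * ((1 + \<rho>) ^ s - 1)"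
proof -
  let ?I = "{C. C \<subseteq> U \<and> card C = s}"
  let ?W = "\<lambda>E. real (card {C \<in> ?I. all_pairs C \<subseteq> E})"
  let ?N = "s choose 2"
  let ?p = "random_graph n"
  have finU: "finite U" using U finite_subset by blast
  have finI: "finite ?I" using finU by simp
  have cardI: "card ?I = m choose s" using finU U by (simp add: n_subsets)
  have \<mu>: "0 < \<mu>" using s by (simp add: \<mu>_def)
  have pairs: "all_pairs C \<subseteq> all_pairs {..<n}" if "C \<in> ?I" for C
    using that U all_pairs_mono by blast
  have card1: "card (all_pairs C) = ?N" if "C \<in> ?I" for C
    using that card_all_pairs[OF finite_subset[OF _ finU], of C] by auto
  have EW: "measure_pmf.expectation ?p ?W = \<mu>"
    using expectation_count[of ?I all_pairs n] finI pairs card1 cardI by (simp add: \<mu>_def)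
  have card2: "(1/2 :: real) ^ card (all_pairs C \<union> all_pairs D) =
      (1/2) ^ ?N * (1/2) ^ ?N * 2 ^ (card (C \<inter> D) choose 2)" if "C \<in> ?I" "D \<in> ?I" for C D
  proof -
    have fC: "finite C" "finite D" using that finU finite_subset by auto
    have "card (all_pairs C \<union> all_pairs D) + (card (C \<inter> D) choose 2) = ?N + ?N"
      using card_Un_Int[of "all_pairs C" "all_pairs D"] fC card1[OF that(1)] card1[OF that(2)]
      by (simp add: finite_all_pairs all_pairs_Int card_all_pairs)
    then have "(1/2 :: real) ^ card (all_pairs C \<union> all_pairs D) * (1/2) ^ (card (C \<inter> D) choose 2)
        = (1/2) ^ ?N * (1/2) ^ ?N"
      by (metis power_add)
    then show ?thesis by (simp add: field_simps)
  qed
  have sq: "(?W E)\<^sup>2 = real (card {z \<in> ?I \<times> ?I. all_pairs (fst z) \<union> all_pairs (snd z) \<subseteq> E})" for E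
  proof -
    have "{z \<in> ?I \<times> ?I. all_pairs (fst z) \<union> all_pairs (snd z) \<subseteq> E} =
          {C \<in> ?I. all_pairs C \<subseteq> E} \<times> {C \<in> ?I. all_pairs C \<subseteq> E}" by auto
    then show ?thesis by (simp add: card_cartesian_product power2_eq_square)
  qed
  have "measure_pmf.expectation ?p (\<lambda>E. (?W E)\<^sup>2) =
        (\<Sum>z\<in>?I \<times> ?I. (1/2) ^ card (all_pairs (fst z) \<union> all_pairs (snd z)))"
    unfolding sq
  proof (rule expectation_count)
    show "all_pairs (fst z) \<union> all_pairs (snd z) \<subseteq> all_pairs {..<n}" if "z \<in> ?I \<times> ?I" for z
      using pairs[of "fst z"] pairs[of "snd z"] that by (auto simp: mem_Times_iff)
  qed (use finI in auto)
  also have "\<dots> = (\<Sum>C\<in>?I. \<Sum>D\<in>?I. (1/2) ^ card (all_pairs C \<union> all_pairs D))"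
    by (simp add: sum.cartesian_product case_prod_beta)
  also have "\<dots> = (\<Sum>C\<in>?I. \<Sum>D\<in>?I. (1/2) ^ ?N * (1/2) ^ ?N * 2 ^ (card (C \<inter> D) choose 2))"
    by (intro sum.cong refl card2)
  also have "\<dots> = (\<Sum>C\<in>?I. (1/2) ^ ?N * (1/2) ^ ?N * (\<Sum>D\<in>?I. 2 ^ (card (C \<inter> D) choose 2)))"
    by (simp add: sum_distrib_left)
  also have "\<dots> \<le> (\<Sum>C\<in>?I. (1/2) ^ ?N * (1/2) ^ ?N * (real (m choose s) * (1 + \<rho>) ^ s))"
    using overlap_sum_le[OF finU _ _ U(2)] unfolding \<rho>_def
    by (intro sum_mono mult_left_mono) auto
  also have "\<dots> = \<mu>\<^sup>2 * (1 + \<rho>) ^ s"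
    by (simp add: cardI \<mu>_def power2_eq_square)
  finally have EW2: "measure_pmf.expectation ?p (\<lambda>E. (?W E)\<^sup>2) \<le> \<mu>\<^sup>2 * (1 + \<rho>) ^ s" .
  have "measure_pmf.expectation ?p (\<lambda>E. (?W E - \<mu>)\<^sup>2) =
        measure_pmf.expectation ?p (\<lambda>E. (?W E)\<^sup>2 - 2 * \<mu> * ?W E + \<mu>\<^sup>2)"
    by (simp add: power2_diff algebra_simps)
  also have "\<dots> = measure_pmf.expectation ?p (\<lambda>E. (?W E)\<^sup>2) - \<mu>\<^sup>2"
    using EW by (simp add: power2_eq_square)
  also have "\<dots> \<le> \<mu>\<^sup>2 * ((1 + \<rho>) ^ s - 1)" using EW2 by (simp add: algebra_simps)
  finally have var: "measure_pmf.expectation ?p (\<lambda>E. (?W E - \<mu>)\<^sup>2) \<le> \<mu>\<^sup>2 * ((1 + \<rho>) ^ s - 1)" .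
  have "measure_pmf.prob ?p {E. ?W E \<le> \<mu> / 2} \<le> measure_pmf.prob ?p {E. \<mu>\<^sup>2 / 4 \<le> (?W E - \<mu>)\<^sup>2}"
  proof (rule measure_pmf.finite_measure_mono)
    show "{E. ?W E \<le> \<mu> / 2} \<subseteq> {E. \<mu>\<^sup>2 / 4 \<le> (?W E - \<mu>)\<^sup>2}"
    proof clarify
      fix E assume "?W E \<le> \<mu> / 2"
      then have "(\<mu> / 2)\<^sup>2 \<le> (\<mu> - ?W E)\<^sup>2" using \<mu> by (intro power_mono) auto
      then show "\<mu>\<^sup>2 / 4 \<le> (?W E - \<mu>)\<^sup>2" by (simp add: power_divide power2_commute)
    qed
  qed simp
  also have "\<dots> \<le> measure_pmf.expectation ?p (\<lambda>E. (?W E - \<mu>)\<^sup>2) / (\<mu>\<^sup>2 / 4)"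
    using \<mu> by (intro markov_random_graph) auto
  also have "\<dots> \<le> \<mu>\<^sup>2 * ((1 + \<rho>) ^ s - 1) / (\<mu>\<^sup>2 / 4)"
    using var \<mu> by (intro divide_right_mono) auto
  also have "\<dots> = 4 * ((1 + \<rho>) ^ s - 1)" using \<mu> by (simp add: field_simps)
  finally show ?thesis by simp
qed

subsection \<open>Expected number of barrier states\<close>

text \<open>The left side is an elementary symmetric polynomial. After division of the weights by
  \<open>W\<close>, it is at most the full product of \<open>1 + w v / W\<close>, hence at most
  \<open>exp 1\<close>. The factor \<open>1 / fact r\<close> given up here is subexponential in
  \<open>L\<^sup>2\<close> at the scales used later.\<close>

lemma sum_weighted_subsets_le:
  fixes w :: "'a \<Rightarrow> real"
  assumes "finite V" "\<And>v. v \<in> V \<Longrightarrow> 0 \<le> w v" "sum w V \<le> W" "0 < W"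
  shows "(\<Sum>R | R \<subseteq> V \<and> card R = r. \<Prod>v\<in>R. w v) \<le> exp 1 * W ^ r"
proof -
  have "(\<Sum>R | R \<subseteq> V \<and> card R = r. \<Prod>v\<in>R. w v) =
        (\<Sum>R | R \<subseteq> V \<and> card R = r. \<Prod>v\<in>R. w v / W) * W ^ r"
    unfolding sum_distrib_right using assms(4) by (intro sum.cong) (auto simp: prod_dividef)
  also have "\<dots> \<le> (\<Sum>R\<in>Pow V. \<Prod>v\<in>R. w v / W) * W ^ r"
    using assms finite_subset
    by (intro mult_right_mono sum_mono2 prod_nonneg) (auto intro!: prod_nonneg divide_nonneg_pos)
  also have "(\<Sum>R\<in>Pow V. \<Prod>v\<in>R. w v / W) = (\<Prod>v\<in>V. w v / W + 1)"
    using prod_add[OF assms(1), of "\<lambda>v. w v / W" "\<lambda>_. 1"] by simp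
  also have "\<dots> \<le> (\<Prod>v\<in>V. exp (w v / W))"
    using assms by (intro prod_mono) (auto simp: add.commute intro!: add_nonneg_nonneg divide_nonneg_pos)
  also have "\<dots> = exp (sum w V / W)"
    using assms(1) by (simp add: exp_sum sum_divide_distrib)
  also have "\<dots> \<le> exp 1" using assms by simp
  finally show ?thesis using assms(4) by (simp add: mult_right_mono)
qed

text \<open>Planted vertices get weight \<open>a\<close> and all others weight 1. Since there are
  few planted vertices, the total weight stays within \<open>2 * n\<close>, so the tilt by
  \<open>a\<close> is almost free.\<close>

lemma sum_planted_weight_le:
  fixes a :: real
  assumes "PC \<subseteq> {..<n}" "0 \<le> a" "real (card PC) * a \<le> real n" "0 < n"
  shows "(\<Sum>R | R \<subseteq> {..<n} \<and> card R = r. a ^ card (R \<inter> PC)) \<le> exp 1 * (2 * real n) ^ r"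
proof -
  let ?w = "\<lambda>v. if v \<in> PC then a else 1"
  have "sum ?w {..<n} = real (card PC) * a + real (card ({..<n} - PC))"
    using assms(1) by (simp add: sum.If_cases Int_absorb1 Int_absorb2 Diff_eq)
  also have "real (card ({..<n} - PC)) \<le> real n"
    using card_mono[of "{..<n}" "{..<n} - PC"] by simp
  finally have W: "sum ?w {..<n} \<le> 2 * real n" using assms by simp
  have "(\<Sum>R | R \<subseteq> {..<n} \<and> card R = r. a ^ card (R \<inter> PC)) =
        (\<Sum>R | R \<subseteq> {..<n} \<and> card R = r. \<Prod>v\<in>R. ?w v)"
  proof (rule sum.cong[OF refl])
    fix R assume "R \<in> {R. R \<subseteq> {..<n} \<and> card R = r}"
    then have "finite R" using finite_subset by auto
    then show "a ^ card (R \<inter> PC) = (\<Prod>v\<in>R. ?w v)" by (simp add: prod.If_cases)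
  qed
  also have "\<dots> \<le> exp 1 * (2 * real n) ^ r"
    using assms W by (intro sum_weighted_subsets_le) auto
  finally show ?thesis .
qed

text \<open>These are the pairs whose adjacency is still random after planting; the pairs inside
  \<open>PC\<close> are adjacent for certain.\<close>

abbreviation free_pairs :: "nat set \<Rightarrow> nat set \<Rightarrow> nat set set" where
  "free_pairs PC S \<equiv> all_pairs S - all_pairs PC"

lemma card_free_pairs:
  assumes "finite S"
  shows "card (free_pairs PC S) + (card (S \<inter> PC) choose 2) = card S choose 2"
proof -
  have "card (all_pairs S) = card (all_pairs S \<inter> all_pairs PC) + card (free_pairs PC S)"
    using assms by (simp add: card_Int_Diff finite_all_pairs)
  then show ?thesis using assms by (simp add: all_pairs_Int card_all_pairs)
qed

lemma cliques_iff_all_pairs: "C \<in> cliques n E \<longleftrightarrow> C \<subseteq> {..<n} \<and> all_pairs C \<subseteq> E"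
proof -
  have "(\<forall>u\<in>C. \<forall>v\<in>C. u \<noteq> v \<longrightarrow> {u, v} \<in> E) \<longleftrightarrow> all_pairs C \<subseteq> E"
  proof
    assume "all_pairs C \<subseteq> E"
    then have "{u, v} \<in> E" if "u \<in> C" "v \<in> C" "u \<noteq> v" for u v
      using that by (auto simp: all_pairs_def subset_iff)
    then show "\<forall>u\<in>C. \<forall>v\<in>C. u \<noteq> v \<longrightarrow> {u, v} \<in> E" by blast
  qed (auto simp: all_pairs_def card_2_iff)
  then show ?thesis by (simp add: cliques_def)
qed

lemma planted_cliques_iff:
  "C \<in> cliques n (E \<union> all_pairs PC) \<longleftrightarrow> C \<subseteq> {..<n} \<and> free_pairs PC C \<subseteq> E"
  unfolding cliques_iff_all_pairs by blast

lemma free_pairs_vertices: "S \<subseteq> {..<n} \<Longrightarrow> free_pairs PC S \<subseteq> all_pairs {..<n}"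
  using all_pairs_mono by blast

lemma half_power_eq: "b + c = d \<Longrightarrow> (1/2::real) ^ b = (1/2) ^ d * 2 ^ c"
  by (auto simp: power_add field_simps)

text \<open>The \<open>g choose 2\<close> planted pairs cost no probability, which gives the factor
  \<open>2 ^ (g choose 2)\<close>. Every set counted has exactly \<open>g\<close> planted vertices
  and so weight \<open>a ^ g\<close> in the tilted sum; dividing by \<open>a ^ g\<close> records how
  rare such sets are.\<close>

lemma crossings_count:
  assumes PC: "PC \<subseteq> {..<n}" and a: "0 < a" "real (card PC) * a \<le> real n" and n: "0 < n"
    and M: "0 < M"
  shows "measure_pmf.prob (random_graph n)
     {E. M * (exp 1 * (2 * real n) ^ s * (1/2) ^ (s choose 2) * (2 ^ (g choose 2) / a ^ g))
          \<le> real (card (crossings n (E \<union> all_pairs PC) PC s g))} \<le> 1 / M"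
proof -
  let ?I = "{C. C \<subseteq> {..<n} \<and> card C = s \<and> card (C \<inter> PC) = g}"
  have cr: "crossings n (E \<union> all_pairs PC) PC s g = {C \<in> ?I. free_pairs PC C \<subseteq> E}" for E
    by (auto simp: crossings_def planted_cliques_iff)
  have "(\<Sum>C\<in>?I. (1/2::real) ^ card (free_pairs PC C)) =
        (\<Sum>C\<in>?I. a ^ card (C \<inter> PC)) * ((1/2) ^ (s choose 2) * (2 ^ (g choose 2) / a ^ g))"
    unfolding sum_distrib_right
  proof (rule sum.cong[OF refl])
    fix C assume C: "C \<in> ?I"
    then have "finite C" using finite_subset by auto
    then have "card (free_pairs PC C) + (g choose 2) = s choose 2"
      using card_free_pairs[of C PC] C by simp
    then show "(1/2::real) ^ card (free_pairs PC C) =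
        a ^ card (C \<inter> PC) * ((1/2) ^ (s choose 2) * (2 ^ (g choose 2) / a ^ g))"
      using C a half_power_eq[of "card (free_pairs PC C)" "g choose 2" "s choose 2"] by simp
  qed
  also have "\<dots> \<le> (exp 1 * (2 * real n) ^ s) * ((1/2) ^ (s choose 2) * (2 ^ (g choose 2) / a ^ g))"
  proof (rule mult_right_mono)
    have "(\<Sum>C\<in>?I. a ^ card (C \<inter> PC)) \<le> (\<Sum>C | C \<subseteq> {..<n} \<and> card C = s. a ^ card (C \<inter> PC))"
      using a by (intro sum_mono2) auto
    also have "\<dots> \<le> exp 1 * (2 * real n) ^ s"
      using a by (intro sum_planted_weight_le PC n) auto
    finally show "(\<Sum>C\<in>?I. a ^ card (C \<inter> PC)) \<le> exp 1 * (2 * real n) ^ s" .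
  qed (use a in auto)
  finally have "(\<Sum>C\<in>?I. (1/2::real) ^ card (free_pairs PC C)) \<le>
     exp 1 * (2 * real n) ^ s * (1/2) ^ (s choose 2) * (2 ^ (g choose 2) / a ^ g)"
    by (simp add: mult.assoc)
  then show ?thesis
    unfolding cr using a n M by (intro count_exceeds free_pairs_vertices) auto
qed

lemma choose_two_add: "((y + z) choose 2) = (y choose 2) + (z choose 2) + y * z"
proof -
  have "real ((y + z) choose 2) = real ((y choose 2) + (z choose 2) + y * z)"
    by (simp add: real_choose_two field_simps)
  then show ?thesis by (simp only: of_nat_eq_iff)
qed

text \<open>Here \<open>y\<close> counts new planted vertices and \<open>z\<close> planted vertices
  already present. The exponent is the number of edges that the new ones save; each accounts for at
  most \<open>y + z \<le> g - 1\<close> of them, and its weight \<open>a\<close> covers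
  that.\<close>

lemma power_choose_two_growth:
  fixes a :: real
  assumes "y + z < g" "2 ^ (g - 1) \<le> a"
  shows "2 ^ ((y choose 2) + y * z) \<le> a ^ y"
proof -
  have "y choose 2 \<le> y * y" using zero_le_mult_iff
    by (cases y) (auto simp: choose_two)
  then have "(y choose 2) + y * z \<le> y * (y + z)" by (simp add: distrib_left)
  also have "\<dots> \<le> y * (g - 1)" using assms by (intro mult_left_mono) auto
  finally have "(2::real) ^ ((y choose 2) + y * z) \<le> (2 ^ (g - 1)) ^ y"
    by (simp add: power_mult[symmetric] mult.commute)
  also have "\<dots> \<le> a ^ y" using assms by (intro power_mono) auto
  finally show ?thesis .
qed

text \<open>A first moment over triples \<open>(C, D, R)\<close>. The cliques \<open>C\<close> and
  \<open>R \<union> D\<close> meet exactly in \<open>D\<close>, so the pairs inside \<open>D\<close>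
  are required only once. Planted vertices of \<open>C\<close> and of \<open>R\<close> are paid for
  by their weights \<open>a\<close>; those of \<open>D\<close> are already paid for as part of
  \<open>C\<close>. The factor \<open>2 ^ q\<close> bounds the choices of \<open>D\<close>.\<close>

lemma gateways_count:
  assumes PC: "PC \<subseteq> {..<n}" and a: "2 ^ (g - 1) \<le> a" "real (card PC) * a \<le> real n" and n: "0 < n"
    and M: "0 < M" and rq: "r \<le> q"
  shows "measure_pmf.prob (random_graph n)
     {E. M * ((exp 1 * (2 * real n) ^ q) * (2 ^ q * (exp 1 * (2 * real n) ^ r)) *
              ((1/2) ^ (q choose 2) * (1/2) ^ ((q choose 2) - ((q - r) choose 2))))
          \<le> real (card (gateways n (E \<union> all_pairs PC) PC q r g))} \<le> 1 / M"
    (is "measure_pmf.prob _ {E. M * ?b \<le> _} \<le> _")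
proof -
  let ?CC = "{C. C \<subseteq> {..<n} \<and> card C = q}" and ?RR = "{R. R \<subseteq> {..<n} \<and> card R = r}"
  let ?S = "Sigma ?CC (\<lambda>C. Pow C \<times> ?RR)"
  let ?J = "{(C, D, R) \<in> ?S. card (C \<inter> PC) < g \<and> card D = q - r \<and> R \<inter> C = {} \<and> card ((R \<union> D) \<inter> PC) < g}"
  let ?F = "\<lambda>(C, D, R). free_pairs PC C \<union> free_pairs PC (R \<union> D)"
  let ?K = "(1/2::real) ^ (q choose 2) * (1/2) ^ ((q choose 2) - ((q - r) choose 2))"
  let ?h = "\<lambda>(C, D, R). a ^ card (C \<inter> PC) * a ^ card (R \<inter> PC)"
  have a0: "0 < a" using a(1) by (meson less_le_trans zero_less_numeral zero_less_power)
  have finS: "finite ?S" by (auto intro!: finite_SigmaI intro: finite_subset)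
  have finJ: "finite ?J" by (rule finite_subset[OF _ finS]) auto
  have term_le: "(1/2::real) ^ card (?F z) \<le> ?K * ?h z" if "z \<in> ?J" for z
  proof -
    obtain C D R where z: "z = (C, D, R)" by (cases z)
    with that have CDR: "C \<subseteq> {..<n}" "card C = q" "D \<subseteq> C" "R \<subseteq> {..<n}" "card R = r"
      "card (C \<inter> PC) < g" "card D = q - r" "R \<inter> C = {}" "card ((R \<union> D) \<inter> PC) < g" by auto
    have fin: "finite C" "finite D" "finite R" using CDR finite_subset by (blast intro: finite_subset)+
    define u y z' where "u = card (C \<inter> PC)" and "y = card (R \<inter> PC)" and "z' = card (D \<inter> PC)"
    have "(R \<union> D) \<inter> PC = (R \<inter> PC) \<union> (D \<inter> PC)" "(R \<inter> PC) \<inter> (D \<inter> PC) = {}" using CDR by auto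
    then have yz: "card ((R \<union> D) \<inter> PC) = y + z'"
      using fin by (simp add: card_Un_disjoint y_def z'_def)
    have RD: "card (R \<union> D) = q" using fin CDR rq by (subst card_Un_disjoint) auto
    have "free_pairs PC C \<inter> free_pairs PC (R \<union> D) = free_pairs PC D"
    proof -
      have "C \<inter> (R \<union> D) = D" using CDR by auto
      then have "all_pairs C \<inter> all_pairs (R \<union> D) = all_pairs D" by (simp only: all_pairs_Int)
      then show ?thesis by blast
    qed
    then have "card (?F z) + card (free_pairs PC D) = card (free_pairs PC C) + card (free_pairs PC (R \<union> D))"
      using card_Un_Int[of "free_pairs PC C" "free_pairs PC (R \<union> D)"] fin
      by (simp add: z finite_all_pairs)
    moreover have "card (free_pairs PC C) + (u choose 2) = q choose 2"
      using card_free_pairs[OF fin(1), of PC] CDR by (simp add: u_def)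
    moreover have "card (free_pairs PC (R \<union> D)) + ((y + z') choose 2) = q choose 2"
      using card_free_pairs[of "R \<union> D" PC] fin yz RD by simp
    moreover have "card (free_pairs PC D) + (z' choose 2) = (q - r) choose 2"
      using card_free_pairs[OF fin(2), of PC] CDR by (simp add: z'_def)
    moreover have "(q - r) choose 2 \<le> q choose 2" by (simp add: binomial_right_mono)
    \<comment> \<open>In the expansion of \<open>(y + z') choose 2\<close> the term
      \<open>z' choose 2\<close> cancels against the planted pairs of \<open>D\<close>, so
      \<open>R\<close> is charged only for the savings that involve one of its own vertices.\<close>
    ultimately have "card (?F z) + ((u choose 2) + ((y choose 2) + y * z')) =
        (q choose 2) + ((q choose 2) - ((q - r) choose 2))"
      unfolding choose_two_add by linarith
    \<comment> \<open>The summand \<open>u * 0\<close> brings the factor of \<open>C\<close> into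
      the shape of \<open>power_choose_two_growth\<close> with no planted vertices present
      beforehand.\<close>
    then have "(1/2::real) ^ card (?F z) = ?K * (2 ^ ((u choose 2) + u * 0) * 2 ^ ((y choose 2) + y * z'))"
      by (subst half_power_eq, assumption) (simp add: power_add)
    also have "\<dots> \<le> ?K * (a ^ u * a ^ y)"
      using CDR yz a a0
      by (intro mult_left_mono mult_mono power_choose_two_growth[where g = g]) (auto simp: u_def)
    finally show ?thesis by (simp add: z u_def y_def)
  qed
  have "(\<Sum>z\<in>?J. (1/2::real) ^ card (?F z)) \<le> (\<Sum>z\<in>?J. ?K * ?h z)"
    by (intro sum_mono term_le)
  \<comment> \<open>Dropping the remaining conditions on the triple makes the choices of
    \<open>C\<close> and \<open>R\<close> independent, and the sum factors.\<close>
  also have "\<dots> \<le> (\<Sum>z\<in>?S. ?K * ?h z)"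
    using a0 by (intro sum_mono2[OF finS]) (auto simp: split: prod.split)
  also have "\<dots> = (\<Sum>C\<in>?CC. \<Sum>D\<in>Pow C. \<Sum>R\<in>?RR. ?K * (a ^ card (C \<inter> PC) * a ^ card (R \<inter> PC)))"
  proof -
    have "(\<Sum>z\<in>?S. ?K * ?h z) =
        (\<Sum>(C, z)\<in>?S. case z of (D, R) \<Rightarrow> ?K * (a ^ card (C \<inter> PC) * a ^ card (R \<inter> PC)))"
      by (intro sum.cong) auto
    also have "\<dots> = (\<Sum>C\<in>?CC. \<Sum>(D, R)\<in>Pow C \<times> ?RR. ?K * (a ^ card (C \<inter> PC) * a ^ card (R \<inter> PC)))"
      by (rule sum.Sigma[symmetric])
         (auto intro!: finite_cartesian_product intro: finite_subset[OF _ finite_lessThan])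
    finally show ?thesis by (simp only: sum.cartesian_product)
  qed
  also have "\<dots> = (\<Sum>C\<in>?CC. a ^ card (C \<inter> PC) * (2 ^ q * (\<Sum>R\<in>?RR. a ^ card (R \<inter> PC)) * ?K))"
  proof (rule sum.cong[OF refl])
    fix C assume "C \<in> ?CC"
    then have "card (Pow C) = 2 ^ q" using card_Pow[of C] finite_subset by auto
    then show "(\<Sum>D\<in>Pow C. \<Sum>R\<in>?RR. ?K * (a ^ card (C \<inter> PC) * a ^ card (R \<inter> PC))) =
        a ^ card (C \<inter> PC) * (2 ^ q * (\<Sum>R\<in>?RR. a ^ card (R \<inter> PC)) * ?K)"
      by (simp add: sum_distrib_left sum_distrib_right mult_ac)
  qed
  also have "\<dots> = (\<Sum>C\<in>?CC. a ^ card (C \<inter> PC)) * (2 ^ q * (\<Sum>R\<in>?RR. a ^ card (R \<inter> PC))) * ?K"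
    by (simp add: sum_distrib_right mult.assoc)
  also have "\<dots> \<le> ?b"
    using a0 by (intro mult_right_mono mult_mono mult_left_mono sum_planted_weight_le[OF PC _ a(2) n])
      (auto intro!: sum_nonneg mult_nonneg_nonneg)
  finally have E: "(\<Sum>z\<in>?J. (1/2::real) ^ card (?F z)) \<le> ?b" .
  have "{E. M * ?b \<le> real (card (gateways n (E \<union> all_pairs PC) PC q r g))} \<subseteq>
        {E. M * ?b \<le> real (card {z \<in> ?J. ?F z \<subseteq> E})}"
  proof clarify
    fix E assume *: "M * ?b \<le> real (card (gateways n (E \<union> all_pairs PC) PC q r g))"
    have "gateways n (E \<union> all_pairs PC) PC q r g \<subseteq> fst ` {z \<in> ?J. ?F z \<subseteq> E}"
    proof
      fix C assume "C \<in> gateways n (E \<union> all_pairs PC) PC q r g"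
      then obtain D R where C: "C \<in> cliques n (E \<union> all_pairs PC)" "card C = q" "card (C \<inter> PC) < g"
        and DR: "D \<subseteq> C" "card D = q - r" "R \<inter> C = {}" "card R = r"
          "R \<union> D \<in> cliques n (E \<union> all_pairs PC)" "card ((R \<union> D) \<inter> PC) < g"
        unfolding gateways_def mem_Collect_eq by metis
      have "C \<subseteq> {..<n}" "free_pairs PC C \<subseteq> E" "R \<subseteq> {..<n}" "free_pairs PC (R \<union> D) \<subseteq> E"
        using C(1) DR(5) unfolding planted_cliques_iff by auto
      with C DR have "(C, D, R) \<in> {z \<in> ?J. ?F z \<subseteq> E}" by simp
      then show "C \<in> fst ` {z \<in> ?J. ?F z \<subseteq> E}" by (rule image_eqI[rotated]) (rule fst_conv[symmetric])
    qed
    then have "card (gateways n (E \<union> all_pairs PC) PC q r g) \<le> card {z \<in> ?J. ?F z \<subseteq> E}"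
      by (intro surj_card_le finite_subset[OF Collect_subset finJ])
    with * show "M * ?b \<le> real (card {z \<in> ?J. ?F z \<subseteq> E})" by linarith
  qed
  then have "measure_pmf.prob (random_graph n) {E. M * ?b \<le> real (card (gateways n (E \<union> all_pairs PC) PC q r g))}
      \<le> measure_pmf.prob (random_graph n) {E. M * ?b \<le> real (card {z \<in> ?J. ?F z \<subseteq> E})}"
    by (intro measure_pmf.finite_measure_mono) auto
  also have "\<dots> \<le> 1 / M"
  proof (rule count_exceeds[OF finJ _ E])
    show "?F z \<subseteq> all_pairs {..<n}" if z: "z \<in> ?J" for z
    proof -
      obtain C D R where CDR: "z = (C, D, R)" by (cases z)
      then have "C \<subseteq> {..<n}" "R \<union> D \<subseteq> {..<n}" using z by auto
      then show ?thesis using free_pairs_vertices[of C n PC] free_pairs_vertices[of "R \<union> D" n PC] CDR by auto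
    qed
  qed (use n M in auto)
  finally show ?thesis .
qed

subsection \<open>From counting to slow mixing\<close>

definition unplanted_cliques :: "nat \<Rightarrow> nat set set \<Rightarrow> nat set \<Rightarrow> nat \<Rightarrow> nat set set" where
  "unplanted_cliques n E PC s = {C. C \<subseteq> {..<n} - PC \<and> card C = s \<and> all_pairs C \<subseteq> E}"

lemma unplanted_cliques_cliques: "unplanted_cliques n E PC s \<subseteq> cliques n E"
  by (auto simp: unplanted_cliques_def cliques_iff_all_pairs)

lemma prob_gibbs:
  assumes "S \<subseteq> cliques n E"
  shows "measure_pmf.prob (gibbs n E h \<beta>) S =
    (\<Sum>C\<in>S. exp (\<beta> * h (card C))) / (\<Sum>D\<in>cliques n E. exp (\<beta> * h (card D)))"
proof -
  have "finite S" using assms finite_cliques by (rule finite_subset)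
  then have "measure_pmf.prob (gibbs n E h \<beta>) S = (\<Sum>C\<in>S. pmf (gibbs n E h \<beta>) C)"
    by (rule measure_measure_pmf_finite)
  also have "\<dots> = (\<Sum>C\<in>S. exp (\<beta> * h (card C)) / (\<Sum>D\<in>cliques n E. exp (\<beta> * h (card D))))"
    using assms by (intro sum.cong) (auto simp: pmf_gibbs)
  finally show ?thesis by (simp add: sum_divide_distrib)
qed

lemma metropolis_hits_barrier:
  assumes n: "0 < n" and x: "x \<in> cliques n E" "card x \<le> q" "x \<inter> PC = {}"
    and rq: "0 < r" "r \<le> q" "0 < g"
  defines "B \<equiv> gateways n E PC q r g \<union> (\<Union>s\<le>q + r. crossings n E PC s g)"
  shows "measure_pmf.prob (markov_path (metropolis_step n E h \<beta>) x m)
     {X. \<exists>t<length X. q + r \<le> card (X ! t) \<or> g \<le> card (X ! t \<inter> PC)}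
     \<le> measure_pmf.prob (markov_path (metropolis_step n E h \<beta>) x m) {X. set X \<inter> B \<noteq> {}}"
proof (rule measure_pmf.finite_measure_mono_AE)
  show "AE X in markov_path (metropolis_step n E h \<beta>) x m.
      X \<in> {X. \<exists>t<length X. q + r \<le> card (X ! t) \<or> g \<le> card (X ! t \<inter> PC)} \<longrightarrow>
      X \<in> {X. set X \<inter> B \<noteq> {}}"
    unfolding AE_measure_pmf_iff
  proof (intro ballI impI)
    fix X assume X: "X \<in> set_pmf (markov_path (metropolis_step n E h \<beta>) x m)"
      and "X \<in> {X. \<exists>t<length X. q + r \<le> card (X ! t) \<or> g \<le> card (X ! t \<inter> PC)}"
    then obtain t0 where t0: "t0 < length X" "q + r \<le> card (X ! t0) \<or> g \<le> card (X ! t0 \<inter> PC)"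
      by auto
    from markov_path_chain[OF X] have len: "length X = Suc m" and X0: "X ! 0 = x"
      and st: "\<And>i. i < m \<Longrightarrow> X ! Suc i \<in> set_pmf (metropolis_step n E h \<beta> (X ! i))"
      by auto
    have clq: "X ! i \<in> cliques n E" if "i \<le> m" for i
      using that
    proof (induction i)
      case 0
      then show ?case using X0 x by simp
    next
      case (Suc i)
      then show ?case using st[of i] set_pmf_metropolis_step[OF n, of "X ! i" E h \<beta>] by auto
    qed
    have "\<exists>t\<le>m. X ! t \<in> gateways n E PC q r g \<or> (\<exists>s\<le>q + r. X ! t \<in> crossings n E PC s g)"
    proof (rule barrier_crossed[where X = "\<lambda>i. X ! i"])
      show "\<exists>v. X ! Suc i = X ! i \<or> X ! Suc i = sym_diff (X ! i) {v}" if "i < m" for i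
        using metropolis_step_cases[OF n st[OF that]] .
      show "t0 \<le> m" using t0 len by simp
    qed (use clq X0 x rq t0 in auto)
    then obtain t where "t \<le> m" "X ! t \<in> B" unfolding B_def by auto
    moreover from this have "X ! t \<in> set X" using len by simp
    ultimately show "X \<in> {X. set X \<inter> B \<noteq> {}}" by auto
  qed
qed simp

text \<open>The starting set contains all sizes up to \<open>q\<close>, so that a crossing of size
  \<open>s \<le> q\<close> is compared with unplanted cliques of the same size and Gibbs weight;
  larger crossings are compared with size \<open>q\<close>. The number \<open>q + r + 2\<close>
  counts the parts of the barrier: the gateways and the crossings of sizes 0 to
  \<open>q + r\<close>.\<close>

lemma metropolis_escape:
  fixes \<theta> \<delta> \<beta> :: real
  assumes n: "0 < n" and rq: "0 < r" "r \<le> q" "0 < g"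
    and a: "0 < card (unplanted_cliques n E PC q)"
    and gw: "real (card (gateways n E PC q r g)) \<le> \<theta> * card (unplanted_cliques n E PC q)"
    and cr: "\<And>s. s \<le> q + r \<Longrightarrow> real (card (crossings n E PC s g)) * exp (\<beta> * h s) \<le>
        \<theta> * (card (unplanted_cliques n E PC (min s q)) * exp (\<beta> * h (min s q)))"
    and \<theta>: "0 \<le> \<theta>" "(real m + 1) * (real (q + r + 2) * \<theta>) \<le> \<delta>"
  shows "\<exists>x\<in>cliques n E. measure_pmf.prob (markov_path (metropolis_step n E h \<beta>) x m)
     {X. \<exists>t<length X. q + r \<le> card (X ! t) \<or> g \<le> card (X ! t \<inter> PC)} \<le> \<delta>"
proof -
  let ?w = "\<lambda>C. exp (\<beta> * h (card C))" and ?\<pi> = "gibbs n E h \<beta>"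
  define A where "A = {C \<in> cliques n E. card C \<le> q \<and> C \<inter> PC = {}}"
  define B where "B = gateways n E PC q r g \<union> (\<Union>s\<le>q + r. crossings n E PC s g)"
  define Z where "Z = (\<Sum>D\<in>cliques n E. ?w D)"
  have Z: "0 < Z" unfolding Z_def by (rule partition_function_pos)
  have subA: "A \<subseteq> cliques n E" and subB: "B \<subseteq> cliques n E"
    by (auto simp: A_def B_def gateways_def crossings_def)
  have fin: "finite S" if "S \<subseteq> cliques n E" for S
    using that finite_cliques by (rule finite_subset)
  have lower: "card (unplanted_cliques n E PC s) * exp (\<beta> * h s) \<le> sum ?w A" if "s \<le> q" for s
  proof -
    have "card (unplanted_cliques n E PC s) * exp (\<beta> * h s) = sum ?w (unplanted_cliques n E PC s)"
      by (subst sum.cong[OF refl, where h = "\<lambda>_. exp (\<beta> * h s)"]) (auto simp: unplanted_cliques_def)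
    also have "\<dots> \<le> sum ?w A"
      using that unplanted_cliques_cliques[of n E PC s] subA
      by (intro sum_mono2 fin) (auto simp: A_def unplanted_cliques_def)
    finally show ?thesis .
  qed
  have prob: "measure_pmf.prob ?\<pi> S = sum ?w S / Z" if "S \<subseteq> cliques n E" for S
    using prob_gibbs[OF that] by (simp add: Z_def)
  have gwA: "measure_pmf.prob ?\<pi> (gateways n E PC q r g) \<le> \<theta> * measure_pmf.prob ?\<pi> A"
  proof -
    have "sum ?w (gateways n E PC q r g) = card (gateways n E PC q r g) * exp (\<beta> * h q)"
      by (subst sum.cong[OF refl, where h = "\<lambda>_. exp (\<beta> * h q)"]) (auto simp: gateways_def)
    also have "\<dots> \<le> \<theta> * (card (unplanted_cliques n E PC q) * exp (\<beta> * h q))"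
      using mult_right_mono[OF gw, of "exp (\<beta> * h q)"] by (simp add: mult.assoc)
    also have "\<dots> \<le> \<theta> * sum ?w A" using lower[of q] \<theta> by (intro mult_left_mono) auto
    finally have "sum ?w (gateways n E PC q r g) \<le> \<theta> * sum ?w A" .
    moreover have "gateways n E PC q r g \<subseteq> cliques n E" by (auto simp: gateways_def)
    ultimately show ?thesis using Z subA by (simp add: prob divide_right_mono)
  qed
  have crA: "measure_pmf.prob ?\<pi> (crossings n E PC s g) \<le> \<theta> * measure_pmf.prob ?\<pi> A"
    if "s \<le> q + r" for s
  proof -
    have "sum ?w (crossings n E PC s g) = card (crossings n E PC s g) * exp (\<beta> * h s)"
      by (subst sum.cong[OF refl, where h = "\<lambda>_. exp (\<beta> * h s)"]) (auto simp: crossings_def)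
    also have "\<dots> \<le> \<theta> * (card (unplanted_cliques n E PC (min s q)) * exp (\<beta> * h (min s q)))"
      using cr[OF that] .
    also have "\<dots> \<le> \<theta> * sum ?w A" using lower[of "min s q"] \<theta> by (intro mult_left_mono) auto
    finally have "sum ?w (crossings n E PC s g) \<le> \<theta> * sum ?w A" .
    moreover have "crossings n E PC s g \<subseteq> cliques n E" by (auto simp: crossings_def)
    ultimately show ?thesis using Z subA by (simp add: prob divide_right_mono)
  qed
  have "measure_pmf.prob ?\<pi> B \<le> measure_pmf.prob ?\<pi> (gateways n E PC q r g) +
      measure_pmf.prob ?\<pi> (\<Union>s\<le>q + r. crossings n E PC s g)"
    unfolding B_def by (rule measure_Un_le) auto
  also have "measure_pmf.prob ?\<pi> (\<Union>s\<le>q + r. crossings n E PC s g) \<le>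
      (\<Sum>s\<le>q + r. measure_pmf.prob ?\<pi> (crossings n E PC s g))"
    by (rule measure_UNION_le) auto
  also have "\<dots> \<le> (\<Sum>s\<le>q + r. \<theta> * measure_pmf.prob ?\<pi> A)"
    using crA by (intro sum_mono) auto
  also have "\<dots> = real (q + r + 1) * (\<theta> * measure_pmf.prob ?\<pi> A)" by simp
  finally have B: "measure_pmf.prob ?\<pi> B \<le> real (q + r + 2) * \<theta> * measure_pmf.prob ?\<pi> A"
    using gwA by (simp add: algebra_simps)
  have "(real m + 1) * measure_pmf.prob ?\<pi> B \<le> (real m + 1) * (real (q + r + 2) * \<theta> * measure_pmf.prob ?\<pi> A)"
    using B by (intro mult_left_mono) auto
  also have "\<dots> = (real m + 1) * (real (q + r + 2) * \<theta>) * measure_pmf.prob ?\<pi> A"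
    by (simp only: mult.assoc)
  also have "\<dots> \<le> \<delta> * measure_pmf.prob ?\<pi> A"
    using \<theta> by (intro mult_right_mono) auto
  finally have bound: "(real m + 1) * measure_pmf.prob ?\<pi> B \<le> \<delta> * measure_pmf.prob ?\<pi> A" .
  have "0 < card (unplanted_cliques n E PC q) * exp (\<beta> * h q)" using a by simp
  then have "0 < sum ?w A" using lower[of q] by linarith
  then have pos: "0 < measure_pmf.prob ?\<pi> A" using Z subA by (simp add: prob)
  have "finite (set_pmf ?\<pi>)"
    by (rule finite_subset[OF _ finite_cliques[of n E]]) (auto simp: set_pmf_eq pmf_gibbs)
  from stationary_escape[OF gibbs_stationary[OF n] this bound pos]
  obtain x where x: "x \<in> A"
    "measure_pmf.prob (markov_path (metropolis_step n E h \<beta>) x m) {X. set X \<inter> B \<noteq> {}} \<le> \<delta>"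
    by blast
  then have "x \<in> cliques n E" "card x \<le> q" "x \<inter> PC = {}" by (auto simp: A_def)
  then show ?thesis
    using order_trans[OF metropolis_hits_barrier[OF n _ _ _ rq] x(2)[unfolded B_def]] by blast
qed

subsection \<open>Choice of scales\<close>

text \<open>The bound on \<open>2 * K * \<eta>\<close> keeps the change of Gibbs weight over
  \<open>r\<close> sizes within half of the gain from a crossing. The bound
  \<open>\<eta> \<le> 1/8\<close> keeps \<open>q\<close> well below \<open>2 * L\<close>, where
  second moments work, and \<open>3 \<le> \<eta> * L\<close> makes the roundings harmless.\<close>

locale barrier_scales =
  fixes n k q r g :: nat and \<alpha> \<gamma> \<eta> K c L :: real
  assumes L_def: "L = log 2 (real n)" and n_pos: "0 < n"
    and k_le: "real k \<le> real n powr \<alpha>" and k_half: "2 * real k \<le> real n"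
    and q_def: "q = nat \<lceil>(1 + 2 * \<eta>) * L\<rceil>" and r_def: "r = nat \<lfloor>\<eta> * L\<rfloor>"
    and g_def: "g = nat \<lceil>\<gamma> * L\<rceil>"
    and \<alpha>: "0 \<le> \<alpha>" "\<alpha> < 1" and \<gamma>: "0 < \<gamma>" "\<gamma> \<le> 1 - \<alpha>"
    and \<eta>: "0 < \<eta>" "\<eta> \<le> 1/8" and K: "0 < K" "2 * K * \<eta> \<le> \<gamma>\<^sup>2 / 4"
    and c: "0 < c" "4 * c \<le> \<eta>\<^sup>2 / 2" "4 * c \<le> \<gamma>\<^sup>2 / 4"
    and \<eta>L: "3 \<le> \<eta> * L" and L_le_n: "4 * L \<le> real n"
begin

lemma n_eq: "real n = 2 powr L"
  using n_pos by (simp add: L_def)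

lemma L_ge: "24 \<le> L"
proof (rule ccontr)
  have "0 < L" using zero_less_mult_pos[of \<eta> L] \<eta>(1) \<eta>L by linarith
  moreover assume "\<not> 24 \<le> L"
  ultimately have "\<eta> * L < 1/8 * 24"
    using \<eta> by (intro mult_le_less_imp_less) auto
  with \<eta>L show False by simp
qed

lemma q_bounds: "(1 + 2 * \<eta>) * L \<le> real q" "real q \<le> 5/4 * L + 1"
proof -
  have "0 \<le> (1 + 2 * \<eta>) * L" using \<eta> L_ge by simp
  then have "real q = of_int \<lceil>(1 + 2 * \<eta>) * L\<rceil>" by (simp add: q_def)
  moreover have "\<eta> * L \<le> 1/8 * L" using \<eta> L_ge by (intro mult_right_mono) auto
  moreover have "(1 + 2 * \<eta>) * L = L + 2 * (\<eta> * L)" by (simp add: algebra_simps)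
  ultimately show "(1 + 2 * \<eta>) * L \<le> real q" "real q \<le> 5/4 * L + 1"
    by (metis le_of_int_ceiling) (use \<open>real q = _\<close> \<open>\<eta> * L \<le> _\<close> \<open>_ = L + _\<close> in linarith)
qed

lemma r_bounds: "real r \<le> \<eta> * L" "\<eta> * L / 2 \<le> real r" "0 < r"
proof -
  have "real r = of_int \<lfloor>\<eta> * L\<rfloor>" using \<eta>L by (simp add: r_def)
  then show "real r \<le> \<eta> * L" "\<eta> * L / 2 \<le> real r" using \<eta>L by linarith+
  then show "0 < r" using \<eta>L by linarith
qed

lemma g_bounds: "\<gamma> * L \<le> real g" "real g < \<gamma> * L + 1" "0 < g"
proof -
  have pos: "0 < \<gamma> * L" using \<gamma> L_ge by simp
  then have "real g = of_int \<lceil>\<gamma> * L\<rceil>" by (simp add: g_def)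
  then show "\<gamma> * L \<le> real g" "real g < \<gamma> * L + 1" by linarith+
  then show "0 < g" using pos by linarith
qed

lemma qr_bounds: "real q \<le> 2 * L" "real (q + r) \<le> 2 * L" "r \<le> q" "real r \<le> L" "q + r \<le> n"
proof -
  have "\<eta> * L \<le> 1/8 * L" using \<eta> L_ge by (intro mult_right_mono) auto
  then have 1: "real r \<le> 1/8 * L" using r_bounds by linarith
  show "real q \<le> 2 * L" "real (q + r) \<le> 2 * L" "real r \<le> L" using 1 q_bounds L_ge by auto
  have "(1 + 2 * \<eta>) * L = L + 2 * (\<eta> * L)" by (simp add: algebra_simps)
  then show "r \<le> q" using 1 q_bounds(1) L_ge \<eta>L by linarith
  show "q + r \<le> n" using \<open>real (q + r) \<le> 2 * L\<close> L_le_n L_ge by linarith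
qed

section \<open>Comparison of clique counts by size\<close>

definition size_weight :: "nat \<Rightarrow> real" where
  "size_weight s = (2 * real n) ^ s * (1/2) ^ (s choose 2)"

definition expected_unplanted :: "nat \<Rightarrow> real" where
  "expected_unplanted s = real ((n - k) choose s) * (1/2) ^ (s choose 2)"

lemma half_le: "real n / 2 \<le> real (n - k)"
  using k_half by linarith

text \<open>A binomial coefficient \<open>m choose s\<close> is at least \<open>(m / s) ^ s\<close>,
  and here \<open>m = n - k\<close> is at least \<open>n / 2\<close>. This loses
  \<open>(4 * s) ^ s\<close>, which is only 2 to a power of order L log L.\<close>

lemma size_weight_le:
  assumes "s \<le> q"
  shows "size_weight s \<le> (8 * L) powr (2 * L) * expected_unplanted s"
proof -
  have s: "real s \<le> 2 * L" using assms qr_bounds by linarith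
  have sm: "s \<le> n - k" using s half_le L_le_n by linarith
  have "(2 * real n) ^ s \<le> (8 * L) powr (2 * L) * real ((n - k) choose s)"
  proof (cases "s = 0")
    case True
    then show ?thesis using L_ge by (simp add: ge_one_powr_ge_zero)
  next
    case False
    have "2 * real n \<le> 4 * real s * (real (n - k) / real s)"
      using False half_le by simp
    then have "(2 * real n) ^ s \<le> (4 * real s * (real (n - k) / real s)) ^ s"
      by (intro power_mono) auto
    also have "\<dots> = (4 * real s) ^ s * (real (n - k) / real s) ^ s"
      by (simp only: power_mult_distrib)
    also have "\<dots> \<le> (8 * L) powr (2 * L) * real ((n - k) choose s)"
    proof (intro mult_mono binomial_ge_n_over_k_pow_k sm)
      have "(4 * real s) ^ s \<le> (8 * L) ^ s" using s by (intro power_mono) auto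
      also have "\<dots> = (8 * L) powr real s" using L_ge by (simp add: powr_realpow)
      also have "\<dots> \<le> (8 * L) powr (2 * L)" using s L_ge by (intro powr_mono) auto
      finally show "(4 * real s) ^ s \<le> (8 * L) powr (2 * L)" .
    qed auto
    finally show ?thesis .
  qed
  then show ?thesis
    unfolding size_weight_def expected_unplanted_def by (simp add: mult_right_mono flip: mult.assoc)
qed

lemma two_n_half_q: "2 * real n * (1/2) ^ q \<le> 2"
proof -
  have "(1 + 2 * \<eta>) * L = L + 2 * (\<eta> * L)" by (simp add: algebra_simps)
  then have "L \<le> real q" using q_bounds(1) \<eta>L by linarith
  then have "real n \<le> 2 ^ q" unfolding n_eq powr_realpow[symmetric, OF zero_less_numeral]
    by (intro powr_mono) auto
  then show ?thesis by (simp add: field_simps power_one_over)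
qed

text \<open>Since \<open>L \<le> q\<close>, each vertex added beyond size \<open>q\<close>
  multiplies the weight by at most \<open>2 * n * (1/2) ^ q \<le> 2\<close>.\<close>

lemma size_weight_late:
  assumes "s \<le> q + r"
  shows "size_weight s \<le> 2 ^ r * size_weight (min s q)"
proof (cases "s \<le> q")
  case True
  then have "size_weight s \<ge> 0" "min s q = s" by (auto simp: size_weight_def)
  then show ?thesis by (simp add: mult_le_cancel_right1)
next
  case False
  define d where "d = s - q"
  have s: "s = q + d" "d \<le> r" using False assms by (auto simp: d_def)
  have "size_weight s = size_weight q * ((2 * real n * (1/2) ^ q) ^ d * (1/2) ^ (d choose 2))"
    by (simp add: size_weight_def s choose_two_add power_add power_mult_distrib power_mult[symmetric])
  also have "\<dots> \<le> size_weight q * (2 ^ d * 1)"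
    using two_n_half_q by (intro mult_left_mono mult_mono power_mono) (auto simp: size_weight_def power_le_one)
  also have "\<dots> \<le> size_weight q * 2 ^ r"
    using s by (intro mult_left_mono) (auto simp: size_weight_def)
  finally show ?thesis using False by (simp add: min_def mult.commute)
qed

text \<open>
  Each planted vertex is given the weight \<open>2 powr ((1 - \<alpha>) * L)\<close>, which compensates for its scarcity:
  the total weight of all vertices is still at most \<open>2 n\<close>.
\<close>

abbreviation planted_weight :: real where
  "planted_weight \<equiv> 2 powr ((1 - \<alpha>) * L)"

lemma planted_weight_le_n: "real k * planted_weight \<le> real n"
proof -
  have "real k * planted_weight \<le> real n powr \<alpha> * planted_weight"
    using k_le by (rule mult_right_mono) simp
  also have "\<dots> = 2 powr (\<alpha> * L + (1 - \<alpha>) * L)"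
    by (simp add: n_eq powr_powr powr_add mult.commute)
  also have "\<dots> = real n" by (simp add: n_eq algebra_simps)
  finally show ?thesis .
qed

text \<open>This is where \<gamma> \<le> 1 - \<alpha> protects the gateway count: the weight of one
  planted vertex pays for the at most \<open>g - 1\<close> edges charged to it.\<close>

lemma planted_weight_ge: "2 ^ (g - 1) \<le> planted_weight"
proof -
  have "2 ^ (g - 1) = 2 powr (real g - 1)"
    using g_bounds(3) by (simp add: powr_realpow[symmetric] of_nat_diff)
  also have "\<dots> \<le> 2 powr (\<gamma> * L)" using g_bounds by (intro powr_mono) auto
  also have "\<dots> \<le> planted_weight" using \<gamma> L_ge by (intro powr_mono mult_right_mono) auto
  finally show ?thesis .
qed

text \<open>A planted vertex saves \<open>(g - 1) / 2\<close> edges on average, at most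
  \<open>\<gamma> * L / 2\<close>, but costs \<open>(1 - \<alpha>) * L \<ge> \<gamma> * L\<close> in
  choices. The net loss of at least \<open>\<gamma> * L / 2\<close> occurs
  \<open>g \<ge> \<gamma> * L\<close> times.\<close>

lemma crossing_gain: "2 ^ (g choose 2) / planted_weight ^ g \<le> 2 powr (- (\<gamma>\<^sup>2 / 2 * L\<^sup>2))"
proof -
  have "2 ^ (g choose 2) / planted_weight ^ g = 2 powr (real g * ((real g - 1) / 2 - (1 - \<alpha>) * L))"
    by (simp add: powr_realpow[symmetric] real_choose_two powr_powr powr_diff[symmetric] algebra_simps)
  also have "\<dots> \<le> 2 powr (- (\<gamma>\<^sup>2 / 2 * L\<^sup>2))"
  proof (rule powr_mono)
    have aux: "(z - 1) / 2 - y \<le> - (x / 2)" if "x \<le> y" "z < x + 1" for x y z :: real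
      using that by (simp add: field_simps)
    have "\<gamma> * L \<le> (1 - \<alpha>) * L" using \<gamma> L_ge by (intro mult_right_mono) auto
    then have "(real g - 1) / 2 - (1 - \<alpha>) * L \<le> - (\<gamma> * L / 2)" using g_bounds(2) by (rule aux)
    then have "real g * ((real g - 1) / 2 - (1 - \<alpha>) * L) \<le> real g * (- (\<gamma> * L / 2))"
      by (intro mult_left_mono) auto
    also have "\<dots> \<le> (\<gamma> * L) * (- (\<gamma> * L / 2))"
      using g_bounds \<gamma> L_ge by (intro mult_right_mono_neg) auto
    finally show "real g * ((real g - 1) / 2 - (1 - \<alpha>) * L) \<le> - (\<gamma>\<^sup>2 / 2 * L\<^sup>2)"
      by (simp add: power2_eq_square algebra_simps)
  qed simp
  finally show ?thesis .
qed

text \<open>A vertex of \<open>R\<close> has about \<open>2 powr (L + 1)\<close> choices and needs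
  \<open>q - r / 2 - 1/2\<close> new edges on average. The bounds on \<open>q\<close> and
  \<open>r\<close> make the net exponent at most \<open>3/2 - 3/2 * \<eta> * L\<close>, which is at
  most \<open>- \<eta> * L\<close> because \<open>3 \<le> \<eta> * L\<close>. There are at least
  \<open>\<eta> * L / 2\<close> such vertices.\<close>

lemma gateway_gain:
  "(2 * real n) ^ r * (1/2) ^ ((q choose 2) - ((q - r) choose 2)) \<le> 2 powr (- (\<eta>\<^sup>2 / 2 * L\<^sup>2))"
proof -
  have le: "(q - r) choose 2 \<le> q choose 2" by (simp add: binomial_right_mono)
  have two_n: "2 * real n = 2 powr (L + 1)" by (simp add: n_eq powr_add)
  have "(2 * real n) ^ r * (1/2) ^ ((q choose 2) - ((q - r) choose 2)) =
        2 powr (real r * (L + 1) - (real (q choose 2) - real ((q - r) choose 2)))"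
    unfolding two_n using le
    by (simp add: powr_realpow[symmetric] powr_powr powr_diff power_one_over of_nat_diff mult.commute)
  also have "real (q choose 2) - real ((q - r) choose 2) = real r * (real q - real r / 2 - 1/2)"
    using qr_bounds(3) by (simp add: real_choose_two of_nat_diff field_simps)
  also have "real r * (L + 1) - real r * (real q - real r / 2 - 1/2) = real r * (L + 3/2 + real r / 2 - real q)"
    by (simp add: algebra_simps)
  also have "2 powr \<dots> \<le> 2 powr (- (\<eta>\<^sup>2 / 2 * L\<^sup>2))"
  proof (rule powr_mono)
    have "(1 + 2 * \<eta>) * L = L + 2 * (\<eta> * L)" by (simp add: algebra_simps)
    then have "L + 3/2 + real r / 2 - real q \<le> - (\<eta> * L)"
      using q_bounds(1) r_bounds(1) \<eta>L by linarith
    then have "real r * (L + 3/2 + real r / 2 - real q) \<le> real r * (- (\<eta> * L))"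
      by (intro mult_left_mono) auto
    also have "\<dots> \<le> (\<eta> * L / 2) * (- (\<eta> * L))"
      using r_bounds \<eta>L by (intro mult_right_mono_neg) auto
    finally show "real r * (L + 3/2 + real r / 2 - real q) \<le> - (\<eta>\<^sup>2 / 2 * L\<^sup>2)"
      by (simp add: power2_eq_square algebra_simps)
  qed simp
  finally show ?thesis .
qed

section \<open>Typical graphs and slow escape on them\<close>

definition crossing_bound :: "nat \<Rightarrow> real" where
  "crossing_bound s = exp 1 * (2 * real n) ^ s * (1/2) ^ (s choose 2) * (2 ^ (g choose 2) / planted_weight ^ g)"

definition gateway_bound :: real where
  "gateway_bound = (exp 1 * (2 * real n) ^ q) * (2 ^ q * (exp 1 * (2 * real n) ^ r)) *
     ((1/2) ^ (q choose 2) * (1/2) ^ ((q choose 2) - ((q - r) choose 2)))"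

text \<open>The set \<open>E\<close> is the random graph before planting, with \<open>PC\<close>
  fixed, so all probabilities refer to \<open>random_graph\<close>. The factor \<open>real n\<close>
  is the multiplier in Markov's inequality: each upper bound fails with probability at most
  \<open>1 / n\<close>.\<close>

definition typical :: "nat set \<Rightarrow> nat set set \<Rightarrow> bool" where
  "typical PC E \<longleftrightarrow> (\<forall>s\<le>q. expected_unplanted s / 2 < card (unplanted_cliques n E PC s)) \<and>
     (\<forall>s\<le>q + r. real (card (crossings n (E \<union> all_pairs PC) PC s g)) < real n * crossing_bound s) \<and>
     real (card (gateways n (E \<union> all_pairs PC) PC q r g)) < real n * gateway_bound"

text \<open>A factor \<open>2 powr o(L\<^sup>2)\<close> absorbing all losses of the counting estimates.\<close>

definition slack :: real where
  "slack = 32 * 2 powr (3 * L) * (8 * L) powr (2 * L)"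

lemma unplanted_cliques_planted: "unplanted_cliques n (E \<union> all_pairs PC) PC s = unplanted_cliques n E PC s"
proof -
  have "all_pairs C \<inter> all_pairs PC = {}" if "C \<subseteq> {..<n} - PC" for C
  proof -
    have "C \<inter> PC = {}" using that by auto
    then show ?thesis unfolding all_pairs_Int by (auto simp: all_pairs_def)
  qed
  then show ?thesis unfolding unplanted_cliques_def by blast
qed

lemma exp_le_two_powr: "0 \<le> x \<Longrightarrow> exp x \<le> 2 powr (2 * x)" for x :: real
proof -
  assume "0 \<le> x"
  have "exp x = exp 1 powr x" by (simp add: powr_def)
  also have "\<dots> \<le> 4 powr x" using exp_le \<open>0 \<le> x\<close> by (intro powr_mono2) auto
  also have "\<dots> = 2 powr (2 * x)" using powr_powr[of 2 2 x] by simp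
  finally show ?thesis .
qed

lemma gain_exponents: "4 * c * L\<^sup>2 \<le> \<eta>\<^sup>2 / 2 * L\<^sup>2" "4 * c * L\<^sup>2 \<le> \<gamma>\<^sup>2 / 4 * L\<^sup>2"
  using mult_right_mono[OF c(2), of "L\<^sup>2"] mult_right_mono[OF c(3), of "L\<^sup>2"] by auto

text \<open>
  For sizes above \<open>q\<close> the comparison is with starting states of size \<open>q\<close>. This is the only place
  where the Lipschitz condition and the bound on \<open>\<beta>\<close> enter.
\<close>

lemma typical_crossings:
  assumes typ_E: "typical PC E" and s: "s \<le> q + r" and \<beta>: "\<bar>\<beta>\<bar> \<le> K * L"
    and lip: "\<And>i j. real i \<le> 2 * L \<Longrightarrow> real j \<le> 2 * L \<Longrightarrow> i \<le> n \<Longrightarrow> j \<le> n \<Longrightarrow> \<bar>h i - h j\<bar> \<le> \<bar>real i - real j\<bar>"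
  shows "real (card (crossings n (E \<union> all_pairs PC) PC s g)) * exp (\<beta> * h s) \<le>
    slack * 2 powr (- (4 * c * L\<^sup>2)) * (real (card (unplanted_cliques n E PC (min s q))) * exp (\<beta> * h (min s q)))"
proof -
  let ?t = "min s q" and ?J = "(8 * L) powr (2 * L)"
  let ?a = "real (card (unplanted_cliques n E PC ?t))"
  have J: "0 < ?J" using L_ge by simp
  have sw0: "0 \<le> size_weight i" for i by (simp add: size_weight_def)
  have a: "expected_unplanted ?t \<le> 2 * ?a"
    using typ_E unfolding typical_def by (smt (verit) min.cobounded2 field_sum_of_halves)
  \<comment> \<open>The sizes \<open>s\<close> and \<open>?t\<close> differ by at most
    \<open>r \<le> \<eta> * L\<close>, so the weights differ by a factor of at most
    \<open>exp (K * \<eta> * L\<^sup>2)\<close>. This spends half of the exponent in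
    \<open>crossing_gain\<close>.\<close>
  have e: "exp (\<beta> * h s) \<le> 2 powr (\<gamma>\<^sup>2 / 4 * L\<^sup>2) * exp (\<beta> * h ?t)"
  proof -
    have "\<bar>h s - h ?t\<bar> \<le> \<bar>real s - real ?t\<bar>"
    proof (rule lip)
      show "real s \<le> 2 * L" "real ?t \<le> 2 * L" "s \<le> n" "?t \<le> n"
        using s qr_bounds by linarith+
    qed
    also have "\<dots> \<le> \<eta> * L" using s r_bounds(1) by linarith
    finally have "\<bar>\<beta>\<bar> * \<bar>h s - h ?t\<bar> \<le> (K * L) * (\<eta> * L)"
      using \<beta> K L_ge by (intro mult_mono) auto
    moreover have "\<beta> * h s - \<beta> * h ?t \<le> \<bar>\<beta>\<bar> * \<bar>h s - h ?t\<bar>"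
      by (metis abs_ge_self abs_mult right_diff_distrib)
    ultimately have "exp (\<beta> * h s - \<beta> * h ?t) \<le> exp ((K * L) * (\<eta> * L))" by simp
    also have "\<dots> \<le> 2 powr (2 * ((K * L) * (\<eta> * L)))"
      using K L_ge \<eta> by (intro exp_le_two_powr) auto
    also have "\<dots> \<le> 2 powr (\<gamma>\<^sup>2 / 4 * L\<^sup>2)"
    proof (rule powr_mono)
      have "2 * ((K * L) * (\<eta> * L)) = (2 * K * \<eta>) * L\<^sup>2" by (simp add: power2_eq_square)
      also have "\<dots> \<le> \<gamma>\<^sup>2 / 4 * L\<^sup>2" using K by (intro mult_right_mono) auto
      finally show "2 * ((K * L) * (\<eta> * L)) \<le> \<gamma>\<^sup>2 / 4 * L\<^sup>2" .
    qed simp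
    finally have "exp (\<beta> * h s - \<beta> * h ?t) * exp (\<beta> * h ?t) \<le> 2 powr (\<gamma>\<^sup>2 / 4 * L\<^sup>2) * exp (\<beta> * h ?t)"
      by (rule mult_right_mono) simp
    then show ?thesis by (simp flip: exp_add)
  qed
  have cb: "crossing_bound s \<le> 3 * size_weight s * 2 powr (- (\<gamma>\<^sup>2 / 2 * L\<^sup>2))"
    unfolding crossing_bound_def size_weight_def mult.assoc[symmetric]
    using crossing_gain exp_le by (intro mult_mono) auto
  have "real (card (crossings n (E \<union> all_pairs PC) PC s g)) \<le> real n * crossing_bound s"
    using typ_E s unfolding typical_def by (simp add: less_imp_le)
  also have "\<dots> \<le> 2 powr L * (3 * (2 ^ r * size_weight ?t) * 2 powr (- (\<gamma>\<^sup>2 / 2 * L\<^sup>2)))"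
    unfolding n_eq using size_weight_late[OF s]
    by (intro mult_left_mono order_trans[OF cb] mult_right_mono) auto
  \<comment> \<open>The losses are \<open>2 powr L\<close> from Markov's inequality, another
    \<open>2 powr L\<close> from sizes above \<open>q\<close>, and \<open>?J\<close> from comparing
    powers with binomial coefficients; all of them go into \<open>slack\<close>.\<close>
  also have "\<dots> \<le> 2 powr L * (3 * (2 powr L * (?J * (2 * ?a))) * 2 powr (- (\<gamma>\<^sup>2 / 2 * L\<^sup>2)))"
  proof (intro mult_left_mono mult_right_mono mult_mono)
    have "(2::real) ^ r = 2 powr real r" by (simp add: powr_realpow)
    also have "\<dots> \<le> 2 powr L" using qr_bounds by (intro powr_mono) auto
    finally show "(2::real) ^ r \<le> 2 powr L" .
    have "size_weight ?t \<le> ?J * expected_unplanted ?t" by (rule size_weight_le) simp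
    also have "\<dots> \<le> ?J * (2 * ?a)" using a J by (intro mult_left_mono) auto
    finally show "size_weight ?t \<le> ?J * (2 * ?a)" .
  qed (use sw0 in auto)
  also have "\<dots> = 6 * 2 powr (2 * L) * ?J * 2 powr (- (\<gamma>\<^sup>2 / 2 * L\<^sup>2)) * ?a"
    by (simp add: mult_ac powr_add[symmetric])
  finally have "real (card (crossings n (E \<union> all_pairs PC) PC s g)) * exp (\<beta> * h s) \<le>
     (6 * 2 powr (2 * L) * ?J * 2 powr (- (\<gamma>\<^sup>2 / 2 * L\<^sup>2)) * ?a) * (2 powr (\<gamma>\<^sup>2 / 4 * L\<^sup>2) * exp (\<beta> * h ?t))"
    using e by (intro mult_mono) auto
  also have "\<dots> = (6 * 2 powr (2 * L) * ?J) * 2 powr (- (\<gamma>\<^sup>2 / 4 * L\<^sup>2)) * (?a * exp (\<beta> * h ?t))"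
  proof -
    have "2 powr (- (\<gamma>\<^sup>2 / 2 * L\<^sup>2)) * 2 powr (\<gamma>\<^sup>2 / 4 * L\<^sup>2) = 2 powr (- (\<gamma>\<^sup>2 / 4 * L\<^sup>2))"
      by (simp add: powr_add[symmetric] mult.commute)
    then show ?thesis by (simp add: mult_ac)
  qed
  also have "\<dots> \<le> slack * 2 powr (- (4 * c * L\<^sup>2)) * (?a * exp (\<beta> * h ?t))"
  proof (intro mult_right_mono mult_mono)
    show "6 * 2 powr (2 * L) * ?J \<le> slack"
      unfolding slack_def using J L_ge by (intro mult_right_mono mult_mono powr_mono) auto
    show "2 powr (- (\<gamma>\<^sup>2 / 4 * L\<^sup>2)) \<le> 2 powr (- (4 * c * L\<^sup>2))"
      using gain_exponents by (intro powr_mono) auto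
  qed (auto simp: slack_def)
  finally show ?thesis .
qed

text \<open>Gateways and the cliques they are compared with all have size \<open>q\<close>, so this
  is a pure count, without \<open>h\<close> and \<open>\<beta>\<close>. Besides Markov's multiplier,
  the losses are \<open>2 ^ q\<close> for the choice of \<open>D\<close> and the comparison with
  binomial coefficients.\<close>

lemma typical_gateways:
  assumes typ_E: "typical PC E"
  shows "real (card (gateways n (E \<union> all_pairs PC) PC q r g)) \<le>
    slack * 2 powr (- (4 * c * L\<^sup>2)) * real (card (unplanted_cliques n E PC q))"
proof -
  let ?J = "(8 * L) powr (2 * L)" and ?a = "real (card (unplanted_cliques n E PC q))"
  have J: "0 < ?J" using L_ge by simp
  have a: "expected_unplanted q \<le> 2 * ?a"
    using typ_E unfolding typical_def by (smt (verit) order_refl field_sum_of_halves)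
  have "gateway_bound = exp 1 * exp 1 * (2 ^ q * size_weight q) *
      ((2 * real n) ^ r * (1/2) ^ ((q choose 2) - ((q - r) choose 2)))"
    by (simp add: gateway_bound_def size_weight_def mult_ac)
  also have "\<dots> \<le> 3 * 3 * (2 powr (2 * L) * (?J * (2 * ?a))) * 2 powr (- (\<eta>\<^sup>2 / 2 * L\<^sup>2))"
  proof (intro mult_mono gateway_gain exp_le)
    have "(2::real) ^ q = 2 powr real q" by (simp add: powr_realpow)
    also have "\<dots> \<le> 2 powr (2 * L)" using qr_bounds by (intro powr_mono) auto
    finally show "(2::real) ^ q \<le> 2 powr (2 * L)" .
    have "size_weight q \<le> ?J * expected_unplanted q" by (rule size_weight_le) simp
    also have "\<dots> \<le> ?J * (2 * ?a)" using a J by (intro mult_left_mono) auto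
    finally show "size_weight q \<le> ?J * (2 * ?a)" .
  qed (auto simp: size_weight_def)
  also have "\<dots> \<le> 3 * 3 * (2 powr (2 * L) * (?J * (2 * ?a))) * 2 powr (- (4 * c * L\<^sup>2))"
    using gain_exponents by (intro mult_left_mono powr_mono) auto
  finally have gb: "gateway_bound \<le> 3 * 3 * (2 powr (2 * L) * (?J * (2 * ?a))) * 2 powr (- (4 * c * L\<^sup>2))" .
  have "real (card (gateways n (E \<union> all_pairs PC) PC q r g)) \<le> 2 powr L * gateway_bound"
    using typ_E unfolding typical_def by (simp add: less_imp_le n_eq)
  also have "\<dots> \<le> 2 powr L * (3 * 3 * (2 powr (2 * L) * (?J * (2 * ?a))) * 2 powr (- (4 * c * L\<^sup>2)))"
    using gb by (intro mult_left_mono) auto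
  also have "\<dots> = 18 * 2 powr (3 * L) * ?J * 2 powr (- (4 * c * L\<^sup>2)) * ?a"
  proof -
    have "2 powr L * 2 powr (2 * L) = 2 powr (3 * L)" by (simp add: powr_add[symmetric])
    then show ?thesis by (simp add: mult_ac)
  qed
  also have "\<dots> \<le> slack * 2 powr (- (4 * c * L\<^sup>2)) * ?a"
    unfolding slack_def using J by (intro mult_right_mono) auto
  finally show ?thesis .
qed

text \<open>Of the exponent \<open>4 * c * L\<^sup>2\<close>, one quarter pays for the number of
  steps, one half for \<open>slack\<close> and the number of parts of the barrier, and the last
  quarter remains as the failure probability.\<close>

lemma typical_escape:
  assumes typ_E: "typical PC E" and \<beta>: "\<bar>\<beta>\<bar> \<le> K * L"
    and lip: "\<And>i j. real i \<le> 2 * L \<Longrightarrow> real j \<le> 2 * L \<Longrightarrow> i \<le> n \<Longrightarrow> j \<le> n \<Longrightarrow> \<bar>h i - h j\<bar> \<le> \<bar>real i - real j\<bar>"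
    and large: "3 * (2 * L + 2) * slack \<le> 2 powr (2 * c * L\<^sup>2)"
  shows "\<exists>x\<in>cliques n (E \<union> all_pairs PC).
    measure_pmf.prob (markov_path (metropolis_step n (E \<union> all_pairs PC) h \<beta>) x (nat \<lceil>2 powr (c * L\<^sup>2)\<rceil>))
     {X. \<exists>t<length X. q + r \<le> card (X ! t) \<or> g \<le> card (X ! t \<inter> PC)} \<le> 2 powr (- (c * L\<^sup>2))"
proof (rule metropolis_escape[where \<theta> = "slack * 2 powr (- (4 * c * L\<^sup>2))"])
  let ?m = "nat \<lceil>2 powr (c * L\<^sup>2)\<rceil>"
  have slack: "0 < slack" using L_ge by (simp add: slack_def)
  have "0 < expected_unplanted q"
  proof -
    have "q \<le> n - k" using half_le qr_bounds(1) L_le_n by linarith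
    then show ?thesis by (simp add: expected_unplanted_def)
  qed
  then show "0 < card (unplanted_cliques n (E \<union> all_pairs PC) PC q)"
    using typ_E unfolding typical_def unplanted_cliques_planted by (smt (verit) order_refl of_nat_0_less_iff half_gt_zero)
  show "real (card (gateways n (E \<union> all_pairs PC) PC q r g)) \<le>
    slack * 2 powr (- (4 * c * L\<^sup>2)) * real (card (unplanted_cliques n (E \<union> all_pairs PC) PC q))"
    unfolding unplanted_cliques_planted by (rule typical_gateways[OF typ_E])
  show "real (card (crossings n (E \<union> all_pairs PC) PC s g)) * exp (\<beta> * h s) \<le>
    slack * 2 powr (- (4 * c * L\<^sup>2)) *
      (real (card (unplanted_cliques n (E \<union> all_pairs PC) PC (min s q))) * exp (\<beta> * h (min s q)))"
    if "s \<le> q + r" for s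
    unfolding unplanted_cliques_planted by (rule typical_crossings[OF typ_E that \<beta> lip])
  have "1 \<le> 2 powr (c * L\<^sup>2)" using c by (simp add: ge_one_powr_ge_zero)
  \<comment> \<open>Rounding up adds at most 1 and the initial state another 1, each bounded by the
    power itself.\<close>
  then have "real ?m + 1 \<le> 3 * 2 powr (c * L\<^sup>2)" by linarith
  then have "(real ?m + 1) * (real (q + r + 2) * (slack * 2 powr (- (4 * c * L\<^sup>2)))) \<le>
      (3 * 2 powr (c * L\<^sup>2)) * ((2 * L + 2) * (slack * 2 powr (- (4 * c * L\<^sup>2))))"
    using qr_bounds(2) slack L_ge by (intro mult_mono) auto
  also have "\<dots> = (3 * (2 * L + 2) * slack) * 2 powr (- (3 * c * L\<^sup>2))"
  proof -
    have "2 powr (c * L\<^sup>2) * 2 powr (- (4 * c * L\<^sup>2)) = 2 powr (- (3 * c * L\<^sup>2))"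
      by (simp add: powr_add[symmetric] mult.assoc)
    then show ?thesis by (simp add: mult_ac)
  qed
  also have "\<dots> \<le> 2 powr (2 * c * L\<^sup>2) * 2 powr (- (3 * c * L\<^sup>2))"
    using large by (rule mult_right_mono) simp
  also have "\<dots> = 2 powr (- (c * L\<^sup>2))" by (simp add: powr_add[symmetric] mult.assoc)
  finally show "(real ?m + 1) * (real (q + r + 2) * (slack * 2 powr (- (4 * c * L\<^sup>2)))) \<le> 2 powr (- (c * L\<^sup>2))" .
  show "0 \<le> slack * 2 powr (- (4 * c * L\<^sup>2))" using slack by simp
qed (use n_pos r_bounds qr_bounds g_bounds in auto)

text \<open>For \<open>s \<le> q \<le> 5/4 * L + 1\<close> the overlap exponent
  \<open>(s - 1) / 2\<close> is at most \<open>3/4 * L\<close>, so the denominator of order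
  \<open>2 powr L\<close> wins and \<open>s * \<rho>\<close> tends to zero. The hypothesis
  \<open>large\<close> allows the bound \<open>exp x \<le> 1 + 2 * x\<close>.\<close>

lemma prob_few_unplanted:
  assumes PC: "PC \<subseteq> {..<n}" "card PC = k" and s: "s \<le> q"
    and large: "8 * L\<^sup>2 * 2 powr (- (L / 4)) \<le> 1"
  shows "measure_pmf.prob (random_graph n) {E. real (card (unplanted_cliques n E PC s)) \<le> expected_unplanted s / 2}
     \<le> 64 * L\<^sup>2 * 2 powr (- (L / 4))"
proof -
  define \<rho> where "\<rho> = real s / real (n - k) * 2 powr ((real s - 1) / 2)"
  define x where "x = 8 * L\<^sup>2 * 2 powr (- (L / 4))"
  have card: "card ({..<n} - PC) = n - k"
    using PC finite_subset[OF PC(1)] by (simp add: card_Diff_subset)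
  have s2: "real s \<le> 2 * L" using s qr_bounds by linarith
  have sm: "s \<le> n - k" using s2 half_le L_le_n by linarith
  have npos: "0 < real n / 2" using n_pos by simp
  have \<rho>0: "0 \<le> \<rho>" by (simp add: \<rho>_def)
  have "real s * \<rho> = (real s)\<^sup>2 / real (n - k) * 2 powr ((real s - 1) / 2)"
    by (simp add: \<rho>_def power2_eq_square)
  also have "\<dots> \<le> (2 * L)\<^sup>2 / (real n / 2) * 2 powr (3 / 4 * L)"
  proof (intro mult_mono frac_le powr_mono)
    show "(real s)\<^sup>2 \<le> (2 * L)\<^sup>2" using s2 by (intro power_mono) auto
    show "real n / 2 \<le> real (n - k)" by (rule half_le)
    show "(real s - 1) / 2 \<le> 3 / 4 * L" using s q_bounds(2) L_ge by (simp add: field_simps)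
  qed (use npos in auto)
  also have "\<dots> = 8 * L\<^sup>2 * (2 powr (3 / 4 * L) / 2 powr L)"
    by (simp add: n_eq power2_eq_square)
  also have "\<dots> = x" unfolding x_def by (simp add: powr_diff[symmetric])
  finally have sx: "real s * \<rho> \<le> x" .
  have x: "0 \<le> x" "x \<le> 1" using large by (auto simp: x_def)
  have "(1 + \<rho>) ^ s \<le> exp \<rho> ^ s" using \<rho>0 by (intro power_mono) auto
  also have "\<dots> = exp (real s * \<rho>)" by (simp add: exp_of_nat_mult)
  also have "\<dots> \<le> exp x" using sx by simp
  also have "\<dots> \<le> 1 + x + x\<^sup>2" using x by (rule exp_bound)
  also have "\<dots> \<le> 1 + 2 * x" using x by (simp add: power2_eq_square mult_left_le)
  finally have b: "(1 + \<rho>) ^ s \<le> 1 + 2 * x" .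
  have "measure_pmf.prob (random_graph n) {E. real (card (unplanted_cliques n E PC s)) \<le> expected_unplanted s / 2}
     \<le> 4 * ((1 + \<rho>) ^ s - 1)"
    unfolding unplanted_cliques_def expected_unplanted_def \<rho>_def
    by (rule few_cliques_prob) (use card sm in auto)
  also have "\<dots> \<le> 8 * x" using b by simp
  also have "\<dots> = 64 * L\<^sup>2 * 2 powr (- (L / 4))" by (simp add: x_def)
  finally show ?thesis .
qed

lemma prob_typical:
  assumes PC: "PC \<subseteq> {..<n}" "card PC = k"
    and large: "8 * L\<^sup>2 * 2 powr (- (L / 4)) \<le> 1"
  shows "1 - ((2 * L + 1) * (64 * L\<^sup>2 * 2 powr (- (L / 4))) + (2 * L + 2) / 2 powr L)
     \<le> measure_pmf.prob (random_graph n) {E. typical PC E}"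
proof -
  let ?p = "measure_pmf.prob (random_graph n)"
  let ?S = "\<lambda>s. {E. real (card (unplanted_cliques n E PC s)) \<le> expected_unplanted s / 2}"
  let ?C = "\<lambda>s. {E. real n * crossing_bound s \<le> real (card (crossings n (E \<union> all_pairs PC) PC s g))}"
  let ?G = "{E. real n * gateway_bound \<le> real (card (gateways n (E \<union> all_pairs PC) PC q r g))}"
  have pw: "real (card PC) * planted_weight \<le> real n" using planted_weight_le_n PC by simp
  have C: "?p (?C s) \<le> 1 / real n" for s
    unfolding crossing_bound_def by (rule crossings_count) (use PC pw n_pos in auto)
  have G: "?p ?G \<le> 1 / real n"
    unfolding gateway_bound_def
    by (rule gateways_count) (use PC pw n_pos planted_weight_ge qr_bounds in auto)
  have "- {E. typical PC E} = ((\<Union>s\<le>q. ?S s) \<union> (\<Union>s\<le>q + r. ?C s)) \<union> ?G"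
    unfolding typical_def by (auto simp: not_less)
  then have "?p (- {E. typical PC E}) \<le> ?p ((\<Union>s\<le>q. ?S s) \<union> (\<Union>s\<le>q + r. ?C s)) + ?p ?G"
    by (simp only:) (rule measure_Un_le, auto)
  also have "\<dots> \<le> (?p (\<Union>s\<le>q. ?S s) + ?p (\<Union>s\<le>q + r. ?C s)) + ?p ?G"
    by (intro add_right_mono measure_Un_le) auto
  also have "\<dots> \<le> ((\<Sum>s\<le>q. ?p (?S s)) + (\<Sum>s\<le>q + r. ?p (?C s))) + ?p ?G"
    by (intro add_right_mono add_mono measure_UNION_le) auto
  also have "\<dots> \<le> ((\<Sum>s\<le>q. 64 * L\<^sup>2 * 2 powr (- (L / 4))) + (\<Sum>s\<le>q + r. 1 / real n)) + 1 / real n"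
    using prob_few_unplanted[OF PC _ large] C G by (intro add_mono sum_mono) auto
  also have "\<dots> = real (q + 1) * (64 * L\<^sup>2 * 2 powr (- (L / 4))) + real (q + r + 2) / real n"
    by (simp add: add_divide_distrib)
  also have "\<dots> \<le> (2 * L + 1) * (64 * L\<^sup>2 * 2 powr (- (L / 4))) + (2 * L + 2) / real n"
    using qr_bounds by (intro add_mono mult_right_mono divide_right_mono) auto
  finally have "?p (- {E. typical PC E}) \<le>
     (2 * L + 1) * (64 * L\<^sup>2 * 2 powr (- (L / 4))) + (2 * L + 2) / 2 powr L"
    by (simp only: n_eq)
  moreover have "?p (- {E. typical PC E}) = 1 - ?p {E. typical PC E}"
    using measure_pmf.prob_compl[of "{E. typical PC E}" "random_graph n"] by (simp add: Compl_eq_Diff_UNIV)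
  ultimately show ?thesis by linarith
qed

end

subsection \<open>Asymptotics\<close>

lemma prob_bind_pmf_ge:
  assumes "\<And>x. x \<in> set_pmf p \<Longrightarrow> b \<le> measure_pmf.prob (f x) A"
  shows "b \<le> measure_pmf.prob (bind_pmf p f) A"
proof (cases "b \<le> 0")
  case True
  then show ?thesis by (rule order_trans) simp
next
  case False
  have "ennreal b = (\<integral>\<^sup>+ x. ennreal b \<partial>measure_pmf p)" by simp
  also have "\<dots> \<le> (\<integral>\<^sup>+ x. emeasure (measure_pmf (f x)) A \<partial>measure_pmf p)"
    using assms by (intro nn_integral_mono_AE) (auto simp: AE_measure_pmf_iff measure_pmf.emeasure_eq_measure)
  also have "\<dots> = ennreal (measure_pmf.prob (bind_pmf p f) A)"
    by (simp flip: measure_pmf.emeasure_eq_measure)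
  finally show ?thesis using False by (subst (asm) ennreal_le_iff) auto
qed

text \<open>The two draws are independent and can be swapped. With \<open>PC\<close> drawn first, a
  bound that is uniform in \<open>PC\<close> passes to the mixture.\<close>

lemma prob_planted_clique_ge:
  assumes k: "k \<le> n"
    and "\<And>PC. PC \<subseteq> {..<n} \<Longrightarrow> card PC = k \<Longrightarrow>
      b \<le> measure_pmf.prob (random_graph n) {E. (E \<union> all_pairs PC, PC) \<in> S}"
  shows "b \<le> measure_pmf.prob (planted_clique n k) S"
proof -
  let ?T = "{S. S \<subseteq> {..<n} \<and> card S = k}"
  obtain S0 where "S0 \<subseteq> {..<n}" "card S0 = k"
    using k obtain_subset_with_card_n[of k "{..<n}"] by auto
  then have T: "?T \<noteq> {}" "finite ?T" by auto
  have "planted_clique n k = bind_pmf (pmf_of_set ?T) (\<lambda>PC. bind_pmf (random_graph n)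
      (\<lambda>E. return_pmf (E \<union> all_pairs PC, PC)))"
    unfolding planted_clique_def by (rule bind_commute_pmf)
  also have "\<dots> = bind_pmf (pmf_of_set ?T) (\<lambda>PC. map_pmf (\<lambda>E. (E \<union> all_pairs PC, PC)) (random_graph n))"
    by (simp add: map_pmf_def)
  finally show ?thesis
  proof (simp only:, intro prob_bind_pmf_ge)
    fix PC assume "PC \<in> set_pmf (pmf_of_set ?T)"
    then have "PC \<subseteq> {..<n}" "card PC = k" using set_pmf_of_set[OF T] by auto
    then show "b \<le> measure_pmf.prob (map_pmf (\<lambda>E. (E \<union> all_pairs PC, PC)) (random_graph n)) S"
      using assms(2) by (simp add: vimage_def)
  qed
qed

lemma slack_asymptotics:
  fixes c :: real
  assumes "0 < c"
  shows "eventually (\<lambda>L::real. 3 * (2 * L + 2) * (32 * 2 powr (3 * L) * (8 * L) powr (2 * L))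
      \<le> 2 powr (2 * c * L\<^sup>2)) at_top"
  using assms by real_asymp

lemma small_asymptotics:
  "eventually (\<lambda>L::real. 8 * L\<^sup>2 * 2 powr (- (L / 4)) \<le> 1) at_top"
  by real_asymp

lemma planted_half_asymptotics:
  assumes "\<alpha> < 1"
  shows "eventually (\<lambda>n. 2 * real n powr \<alpha> \<le> real n) sequentially"
  using assms by real_asymp

lemma error_tendsto_0:
  "((\<lambda>L::real. (2 * L + 1) * (64 * L\<^sup>2 * 2 powr (- (L / 4))) + (2 * L + 2) / 2 powr L) \<longlongrightarrow> 0) at_top"
  by real_asymp

lemma log2_nat_at_top: "filterlim (\<lambda>n. log 2 (real n)) at_top sequentially"
  by real_asymp

lemma log2_le_nat: "eventually (\<lambda>n. 4 * log 2 (real n) \<le> real n) sequentially"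
  by real_asymp

theorem theorem7p1:
  fixes \<alpha> \<epsilon> \<gamma> K :: real
  assumes "0 \<le> \<alpha>" and "\<alpha> < 1"
    and "0 < \<epsilon>" and "\<epsilon> < 1 - \<alpha>"
    and "0 < \<gamma>" and "\<gamma> \<le> 1 - \<alpha>"
    and "0 < K"
  shows "\<exists>c>0.
    (\<lambda>n. measure_pmf.prob (planted_clique n (nat \<lfloor>real n powr \<alpha>\<rfloor>))
      {(E, PC).
        \<forall>(h :: nat \<Rightarrow> real) (\<beta> :: real).
          h 0 = 0 \<longrightarrow>
          (\<forall>q q'. q \<le> n \<longrightarrow> q' \<le> n \<longrightarrow>
             real q \<le> 2.1 * log 2 (real n) \<longrightarrow> real q' \<le> 2.1 * log 2 (real n) \<longrightarrow>
             \<bar>h q - h q'\<bar> \<le> \<bar>real q - real q'\<bar>) \<longrightarrow>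
          \<bar>\<beta>\<bar> \<le> K * log 2 (real n) \<longrightarrow>
          (\<exists>x0 \<in> cliques n E.
             measure_pmf.prob
               (markov_path (metropolis_step n E h \<beta>) x0
                  (nat \<lceil>real n powr (c * log 2 (real n))\<rceil>))
               {X. \<exists>t < length X. real t < real n powr (c * log 2 (real n)) \<and>
                     (real (card (X ! t)) \<ge> (1 + \<epsilon>) * log 2 (real n) \<or>
                      real (card (X ! t \<inter> PC)) \<ge> \<gamma> * log 2 (real n))}
             \<le> real n powr (- (c * log 2 (real n))))})
    \<longlonglongrightarrow> 1"
proof -
  \<comment> \<open>The first term keeps \<open>q + r\<close> below
    \<open>(1 + \<epsilon>) * L\<close>, and gives \<eta> \<le> 1/8 because \<epsilon> < 1 -
    \<alpha> \<le> 1. The second makes \<open>2 * K * \<eta>\<close> at most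
    \<open>\<gamma>\<^sup>2 / 4\<close>.\<close>
  define \<eta> where "\<eta> = min (\<epsilon> / 8) (\<gamma>\<^sup>2 / (8 * K))"
  define c where "c = min (\<eta>\<^sup>2 / 2) (\<gamma>\<^sup>2 / 4) / 4"
  have eta: "0 < \<eta>" "8 * \<eta> \<le> \<epsilon>" "\<eta> \<le> 1/8"
    using assms by (auto simp: \<eta>_def)
  have "\<eta> \<le> \<gamma>\<^sup>2 / (8 * K)" by (simp add: \<eta>_def)
  then have K\<eta>: "2 * K * \<eta> \<le> \<gamma>\<^sup>2 / 4" using assms(7) by (simp add: field_simps)
  have c: "0 < c" "4 * c \<le> \<eta>\<^sup>2 / 2" "4 * c \<le> \<gamma>\<^sup>2 / 4"
    using eta(1) assms(5) by (auto simp: c_def)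
  let ?good = "\<lambda>n. {(E, PC).
        \<forall>(h :: nat \<Rightarrow> real) (\<beta> :: real).
          h 0 = 0 \<longrightarrow>
          (\<forall>q q'. q \<le> n \<longrightarrow> q' \<le> n \<longrightarrow>
             real q \<le> 2.1 * log 2 (real n) \<longrightarrow> real q' \<le> 2.1 * log 2 (real n) \<longrightarrow>
             \<bar>h q - h q'\<bar> \<le> \<bar>real q - real q'\<bar>) \<longrightarrow>
          \<bar>\<beta>\<bar> \<le> K * log 2 (real n) \<longrightarrow>
          (\<exists>x0 \<in> cliques n E.
             measure_pmf.prob
               (markov_path (metropolis_step n E h \<beta>) x0
                  (nat \<lceil>real n powr (c * log 2 (real n))\<rceil>))
               {X. \<exists>t < length X. real t < real n powr (c * log 2 (real n)) \<and>
                     (real (card (X ! t)) \<ge> (1 + \<epsilon>) * log 2 (real n) \<or>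
                      real (card (X ! t \<inter> PC)) \<ge> \<gamma> * log 2 (real n))}
             \<le> real n powr (- (c * log 2 (real n))))}"
  let ?err = "\<lambda>L::real. (2 * L + 1) * (64 * L\<^sup>2 * 2 powr (- (L / 4))) + (2 * L + 2) / 2 powr L"
  have lower: "eventually (\<lambda>n. 1 - ?err (log 2 (real n)) \<le>
      measure_pmf.prob (planted_clique n (nat \<lfloor>real n powr \<alpha>\<rfloor>)) (?good n)) sequentially"
    using eventually_gt_at_top[of 0] planted_half_asymptotics[OF assms(2)] log2_le_nat
      eventually_compose_filterlim[OF slack_asymptotics[OF c(1)] log2_nat_at_top]
      eventually_compose_filterlim[OF small_asymptotics log2_nat_at_top]
      eventually_compose_filterlim[OF eventually_ge_at_top[of "3 / \<eta>"] log2_nat_at_top]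
  proof eventually_elim
    case (elim n)
    define L where "L = log 2 (real n)"
    define k where "k = nat \<lfloor>real n powr \<alpha>\<rfloor>"
    have "real k = of_int \<lfloor>real n powr \<alpha>\<rfloor>" by (simp add: k_def)
    then have k: "real k \<le> real n powr \<alpha>" by linarith
    interpret barrier_scales n k "nat \<lceil>(1 + 2 * \<eta>) * L\<rceil>" "nat \<lfloor>\<eta> * L\<rfloor>" "nat \<lceil>\<gamma> * L\<rceil>" \<alpha> \<gamma> \<eta> K c L
      by unfold_locales
         (use assms eta K\<eta> c k elim in \<open>auto simp: L_def field_simps\<close>)
    let ?q = "nat \<lceil>(1 + 2 * \<eta>) * L\<rceil>" and ?r = "nat \<lfloor>\<eta> * L\<rfloor>" and ?g = "nat \<lceil>\<gamma> * L\<rceil>"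
    have small: "8 * L\<^sup>2 * 2 powr (- (L / 4)) \<le> 1" using elim by (simp add: L_def)
    have large: "3 * (2 * L + 2) * slack \<le> 2 powr (2 * c * L\<^sup>2)"
      unfolding slack_def using elim by (simp add: L_def)
    have npow: "real n powr (c * log 2 (real n)) = 2 powr (c * L\<^sup>2)"
      "real n powr (- (c * log 2 (real n))) = 2 powr (- (c * L\<^sup>2))"
      unfolding L_def[symmetric] by (simp_all add: n_eq powr_powr power2_eq_square mult_ac)
    \<comment> \<open>Up to rounding, \<open>?q + ?r\<close> is at most
      \<open>L + 3 * \<eta> * L\<close>; the remaining room up to \<open>L + 8 * \<eta> * L\<close>
      absorbs the 1 lost in the ceiling.\<close>
    have size: "real (?q + ?r) \<le> (1 + \<epsilon>) * L"
    proof -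
      have "0 \<le> (1 + 2 * \<eta>) * L" using eta L_ge by simp
      then have "real ?q \<le> (1 + 2 * \<eta>) * L + 1" by linarith
      moreover have "8 * \<eta> * L \<le> \<epsilon> * L" using eta L_ge by (intro mult_right_mono) auto
      moreover have "(1 + 2 * \<eta>) * L = L + 2 * (\<eta> * L)" "(1 + \<epsilon>) * L = L + \<epsilon> * L"
        "8 * \<eta> * L = 8 * (\<eta> * L)"
        by (simp_all add: algebra_simps)
      ultimately show ?thesis using r_bounds(1) \<eta>L unfolding of_nat_add by linarith
    qed
    \<comment> \<open>Being typical depends on neither \<open>h\<close> nor \<open>\<beta>\<close>,
      so a single event on the graph serves all of them at once.\<close>
    have good: "(E \<union> all_pairs PC, PC) \<in> ?good n" if "typical PC E" for PC E
    proof (unfold mem_Collect_eq prod.case, intro allI impI)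
      fix h :: "nat \<Rightarrow> real" and \<beta> :: real
      assume lip: "\<forall>q q'. q \<le> n \<longrightarrow> q' \<le> n \<longrightarrow>
             real q \<le> 2.1 * log 2 (real n) \<longrightarrow> real q' \<le> 2.1 * log 2 (real n) \<longrightarrow>
             \<bar>h q - h q'\<bar> \<le> \<bar>real q - real q'\<bar>"
        and \<beta>: "\<bar>\<beta>\<bar> \<le> K * log 2 (real n)"
      have lip': "\<bar>h s - h s'\<bar> \<le> \<bar>real s - real s'\<bar>"
        if "real s \<le> 2 * L" "real s' \<le> 2 * L" "s \<le> n" "s' \<le> n" for s s'
      proof -
        have "real s \<le> 2.1 * log 2 (real n)" "real s' \<le> 2.1 * log 2 (real n)"
          using that(1,2) L_ge unfolding L_def[symmetric] by linarith+
        then show ?thesis using lip that(3,4) by blast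
      qed
      obtain x where x: "x \<in> cliques n (E \<union> all_pairs PC)" and
        px: "measure_pmf.prob (markov_path (metropolis_step n (E \<union> all_pairs PC) h \<beta>) x (nat \<lceil>2 powr (c * L\<^sup>2)\<rceil>))
          {X. \<exists>t<length X. ?q + ?r \<le> card (X ! t) \<or> ?g \<le> card (X ! t \<inter> PC)} \<le> 2 powr (- (c * L\<^sup>2))"
        using typical_escape[OF \<open>typical PC E\<close> _ lip' large] \<beta> by (auto simp: L_def)
      show "\<exists>x0 \<in> cliques n (E \<union> all_pairs PC).
             measure_pmf.prob
               (markov_path (metropolis_step n (E \<union> all_pairs PC) h \<beta>) x0
                  (nat \<lceil>real n powr (c * log 2 (real n))\<rceil>))
               {X. \<exists>t < length X. real t < real n powr (c * log 2 (real n)) \<and>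
                     (real (card (X ! t)) \<ge> (1 + \<epsilon>) * log 2 (real n) \<or>
                      real (card (X ! t \<inter> PC)) \<ge> \<gamma> * log 2 (real n))}
             \<le> real n powr (- (c * log 2 (real n)))"
      proof (rule bexI[OF _ x], unfold npow, rule order_trans[OF measure_pmf.finite_measure_mono px])
        have "?q + ?r \<le> a" if "(1 + \<epsilon>) * log 2 (real n) \<le> real a" for a
          using that size unfolding L_def[symmetric] by linarith
        moreover have "?g \<le> a" if "\<gamma> * log 2 (real n) \<le> real a" for a
          using that unfolding L_def[symmetric] by (simp add: nat_le_iff ceiling_le_iff)
        \<comment> \<open>Replacing the thresholds by \<open>?q + ?r\<close> and \<open>?g\<close>
          and dropping the strict time limit only enlarges the event.\<close>
        ultimately show "{X. \<exists>t<length X. real t < 2 powr (c * L\<^sup>2) \<and>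
                     (real (card (X ! t)) \<ge> (1 + \<epsilon>) * log 2 (real n) \<or>
                      real (card (X ! t \<inter> PC)) \<ge> \<gamma> * log 2 (real n))} \<subseteq>
          {X. \<exists>t<length X. ?q + ?r \<le> card (X ! t) \<or> ?g \<le> card (X ! t \<inter> PC)}"
          by blast
      qed simp
    qed
    have "1 - ?err L \<le> measure_pmf.prob (planted_clique n k) (?good n)"
    proof (rule prob_planted_clique_ge)
      show "k \<le> n" using k_half by linarith
      fix PC assume PC: "PC \<subseteq> {..<n}" "card PC = k"
      have "1 - ?err L \<le> measure_pmf.prob (random_graph n) {E. typical PC E}"
        by (rule prob_typical[OF PC small])
      also have "\<dots> \<le> measure_pmf.prob (random_graph n) {E. (E \<union> all_pairs PC, PC) \<in> ?good n}"
        using good by (intro measure_pmf.finite_measure_mono subsetI CollectI) simp_all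
      finally show "1 - ?err L \<le> measure_pmf.prob (random_graph n) {E. (E \<union> all_pairs PC, PC) \<in> ?good n}" .
    qed
    then show ?case unfolding L_def k_def .
  qed
  have "((\<lambda>n. ?err (log 2 (real n))) \<longlongrightarrow> 0) sequentially"
    by (rule filterlim_compose[OF error_tendsto_0 log2_nat_at_top])
  then have "((\<lambda>n. 1 - ?err (log 2 (real n))) \<longlongrightarrow> 1 - 0) sequentially"
    by (intro tendsto_diff tendsto_const)
  then have lim: "((\<lambda>n. 1 - ?err (log 2 (real n))) \<longlongrightarrow> 1) sequentially" by simp
  have "(\<lambda>n. measure_pmf.prob (planted_clique n (nat \<lfloor>real n powr \<alpha>\<rfloor>)) (?good n)) \<longlonglongrightarrow> 1"
    by (rule tendsto_sandwich[OF lower _ lim tendsto_const]) simp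
  then show ?thesis using c(1) by (intro exI conjI)
qed

end
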